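(* For every $\varepsilon\in(0,1)$ and $\delta\in(0,1)$ there exists a randomized streaming algorithm in the comparison model that solves the single quantile approximation problem with additive error $\varepsilon n$ and success probability at least $1-\delta$, whose space complexity is $O\big((1/\varepsilon)\sqrt{\log(1/\delta)}\big)$ (independent of the stream length $n$).
   Context: Comparison model: the stream items $x_1,\ldots,x_n$ come from a totally ordered universe and the algorithm may only compare two items. The rank of a value $x$ is $R(x)=|\{i: x_i\le x\}|$. Single quantile approximation problem: the items $x_1,\ldots,x_n$ arrive one by one in arbitrary order ($n$ not known in advance); the algorithm maintains a data structure, and at the end of the stream it receives a single query $x$ and must output $\tilde R(x)$ with $|\tilde R(x)-R(x)|\le \varepsilon n$ with probability at least $1-\delta$. Space is measured in the number of stream items (and machine words) stored.
   Formalization: The space bound is proved as O(max(1, (1/ε)√log(1/δ))): a floor of one word is added, since for δ near 1 the stated expression tends to 0 while an algorithm without any memory cannot solve the problem for all n. *)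

theory Defs
  imports "HOL-Probability.Probability"
begin

text \<open>
  A randomized streaming algorithm in the comparison model. Its memory consists of a list of
  stored stream items and a list of machine words. When an item \<open>x\<close> arrives, the available
  items are the stored ones followed by \<open>x\<close>; the algorithm sees them only through their number
  and the outcomes of pairwise comparisons, plus its own words. It chooses, possibly at random,
  the positions of the items to keep and the new words. Hence an algorithm does not mention the
  universe of items, and it cannot store an item that it has discarded earlier.
  For a query \<open>x\<close>, \<open>answer\<close> sees the stored items followed by \<open>x\<close> in the same way.
\<close>

record streaming_alg =
  init_words :: "nat list"
  update :: "nat \<Rightarrow> (nat \<Rightarrow> nat \<Rightarrow> bool) \<Rightarrow> nat list \<Rightarrow> (nat list \<times> nat list) pmf"
  answer :: "nat \<Rightarrow> (nat \<Rightarrow> nat \<Rightarrow> bool) \<Rightarrow> nat list \<Rightarrow> real pmf"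

type_synonym 'a memory = "'a list \<times> nat list"

definition item_le :: "'a::linorder list \<Rightarrow> nat \<Rightarrow> nat \<Rightarrow> bool" where
  "item_le ys i j \<longleftrightarrow> i < length ys \<and> j < length ys \<and> ys ! i \<le> ys ! j"

definition select_items :: "'a list \<Rightarrow> nat list \<Rightarrow> 'a list" where
  "select_items ys js = map ((!) ys) (filter (\<lambda>j. j < length ys) js)"

definition process_item :: "streaming_alg \<Rightarrow> 'a::linorder \<Rightarrow> 'a memory \<Rightarrow> 'a memory pmf" where
  "process_item A x = (\<lambda>(items, ws).
     map_pmf (\<lambda>(js, ws'). (select_items (items @ [x]) js, ws'))
       (update A (length (items @ [x])) (item_le (items @ [x])) ws))"

definition run_stream :: "streaming_alg \<Rightarrow> 'a::linorder list \<Rightarrow> 'a memory pmf" where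
  "run_stream A xs =
     foldl (\<lambda>p x. bind_pmf p (process_item A x)) (return_pmf ([], init_words A)) xs"

definition query_output :: "streaming_alg \<Rightarrow> 'a::linorder list \<Rightarrow> 'a \<Rightarrow> real pmf" where
  "query_output A xs x =
     bind_pmf (run_stream A xs)
       (\<lambda>(items, ws). answer A (length (items @ [x])) (item_le (items @ [x])) ws)"

definition stream_rank :: "'a::linorder list \<Rightarrow> 'a \<Rightarrow> nat" where
  "stream_rank xs x = card {i. i < length xs \<and> xs ! i \<le> x}"

definition solves_single_quantile ::
    "'a::linorder itself \<Rightarrow> streaming_alg \<Rightarrow> real \<Rightarrow> real \<Rightarrow> bool" where
  "solves_single_quantile _ A \<epsilon> \<delta> \<longleftrightarrow>
     (\<forall>(xs :: 'a list) x.
        measure_pmf.prob (query_output A xs x)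
          {r. \<bar>r - real (stream_rank xs x)\<bar> \<le> \<epsilon> * real (length xs)} \<ge> 1 - \<delta>)"

text \<open>
  Space is worst-case over all streams and all outcomes of the random choices; since every prefix
  of a stream is a stream, the bound holds throughout the execution.
\<close>

definition space_at_most :: "'a::linorder itself \<Rightarrow> streaming_alg \<Rightarrow> real \<Rightarrow> bool" where
  "space_at_most _ A S \<longleftrightarrow>
     (\<forall>(xs :: 'a list). \<forall>(items, ws) \<in> set_pmf (run_stream A xs).
        real (length items + length ws) \<le> S)"

text \<open>
  After \<open>n\<close> items every word fits into \<open>c * log 2 (n + 2)\<close> bits, so that a word cannot encode
  an unbounded amount of data.
\<close>

definition words_fit :: "'a::linorder itself \<Rightarrow> streaming_alg \<Rightarrow> nat \<Rightarrow> bool" where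
  "words_fit _ A c \<longleftrightarrow>
     (\<forall>(xs :: 'a list). \<forall>(items, ws) \<in> set_pmf (run_stream A xs).
        \<forall>w \<in> set ws. w < (length xs + 2) ^ c)"

end

theory Submission
  imports Defs
begin

text \<open>
  The algorithm is the sketch of Karnin, Lang and Liberty with a deterministic schedule. Items of
  weight \<open>2^h\<close> sit in a buffer of level \<open>h\<close>; a full buffer is sorted and every second item, with a
  random parity, moves to level \<open>h + 1\<close>. This changes the estimated rank of a fixed value by \<open>0\<close> or
  by \<open>\<plusminus>2^h\<close> with a fair sign. With top level \<open>H\<close>, where \<open>n\<close> is about \<open>2^(H + K)\<close>, level \<open>h\<close> has
  capacity \<open>2^(K - (H - h) div 2)\<close>. The capacities sum to \<open>O(2^K)\<close>, and since they shrink more slowly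
  than the weights, the squared errors of all compactions sum to \<open>O(n^2 / 4^K)\<close>. Levels below
  \<open>H - (2 K - 2)\<close> are replaced by reservoir sampling from blocks, so that only \<open>O(K)\<close> levels exist.
  All capacities are powers of two, hence at the end of an epoch everything has moved to the top
  level and the epoch \<open>H + 1\<close> can start with empty lower buffers. A moment generating function
  bound gives failure probability \<open>2 exp (- \<Omega>(\<epsilon>^2 4^K))\<close>.

  For \<open>\<delta>\<close> close to \<open>1\<close> the allowed space is much smaller than \<open>1 / \<epsilon>\<close>. With \<open>J\<close> about
  \<open>1 / sqrt (1 - \<delta>)\<close>, the sketch is run with error \<open>J \<epsilon>\<close> and failure probability \<open>1/2\<close>, and the
  answer is moved to a random point of a grid of \<open>J\<close> points with spacing \<open>2 \<epsilon> n\<close>.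
\<close>

section \<open>Halving a sorted buffer and bounding the moments of a two-point variable\<close>

fun alternate :: "bool \<Rightarrow> 'b list \<Rightarrow> 'b list" where
  "alternate b [] = []"
| "alternate b (x # xs) = (if b then x # alternate False xs else alternate True xs)"

lemma map_alternate: "map f (alternate b xs) = alternate b (map f xs)"
  by (induction b xs rule: alternate.induct) auto

lemma length_alternate: "even (length xs) \<Longrightarrow> 2 * length (alternate b xs) = length xs"
proof -
  have "length (alternate b xs) = (if b then (length xs + 1) div 2 else length xs div 2)"
    by (induction b xs rule: alternate.induct) auto
  then show "even (length xs) \<Longrightarrow> ?thesis" by auto
qed

lemma count_alternate_sum:
  "length (filter Q (alternate True xs)) + length (filter Q (alternate False xs)) = length (filter Q xs)"
  by (induction xs) auto

lemma alternate_none: "\<forall>x\<in>set xs. \<not> Q x \<Longrightarrow> filter Q (alternate b xs) = []"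
  by (induction b xs rule: alternate.induct) auto

text \<open>The items up to \<open>x\<close> form a prefix of a sorted list, where the two parities
  differ by at most one. So a compaction errs by at most one item of its level, whatever the buffer
  size.\<close>

lemma count_alternate_sorted:
  fixes xs :: "'a::linorder list"
  assumes "sorted xs"
  shows "length (filter (\<lambda>y. y \<le> x) (alternate True xs)) = length (filter (\<lambda>y. y \<le> x) (alternate False xs))
       \<or> length (filter (\<lambda>y. y \<le> x) (alternate True xs)) = Suc (length (filter (\<lambda>y. y \<le> x) (alternate False xs)))"
  using assms
proof (induction xs)
  case (Cons a xs)
  show ?case
  proof (cases "a \<le> x")
    case True
    then show ?thesis using Cons by auto
  next
    case False
    then have "\<forall>y\<in>set xs. \<not> y \<le> x" using Cons by auto
    then show ?thesis using False by (auto simp: alternate_none)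
  qed
qed auto

text \<open>Hoeffding's lemma for a centred two-point variable of range \<open>t\<close>. It serves
  both sources of randomness: compactions, with \<open>p = 1/2\<close>, and sampling from a
  block.\<close>

lemma two_point_hoeffding:
  fixes p l t :: real
  assumes p: "0 \<le> p" "p \<le> 1"
  shows "p * exp (l * (t * (1 - p))) + (1 - p) * exp (l * (- t * p)) \<le> exp (l\<^sup>2 * t\<^sup>2 / 8)"
proof -
  have pos: "p * exp (l * (t * (1 - p))) + (1 - p) * exp (l * (- t * p)) \<le> exp (l\<^sup>2 * t\<^sup>2 / 8)"
    if t: "t > 0" and l: "l > 0" and p: "0 \<le> p" "p \<le> 1" for p l t :: real
  proof -
    define X where "X b = (if b then t * (1 - p) else - t * p)" for b
    interpret interval_bounded_random_variable "measure_pmf (bernoulli_pmf p)" X "- t * p" "t * (1 - p)"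
      using t by unfold_locales (auto simp: AE_measure_pmf_iff X_def algebra_simps)
    have "measure_pmf.expectation (bernoulli_pmf p) X = 0"
      using p by (simp add: X_def algebra_simps)
    from Hoeffdings_lemma_nn_integral_0[OF l this]
    have "nn_integral (bernoulli_pmf p) (\<lambda>x. exp (l * X x))
      \<le> ennreal (exp (l\<^sup>2 * (t * (1 - p) - (- t * p))\<^sup>2 / 8))" .
    also have "(t * (1 - p) - (- t * p)) = t" by (simp add: algebra_simps)
    also have "nn_integral (bernoulli_pmf p) (\<lambda>x. exp (l * X x))
      = ennreal (p * exp (l * (t * (1 - p))) + (1 - p) * exp (l * (- t * p)))"
      using p by (simp add: X_def ennreal_plus ennreal_mult' mult.commute)
    finally show ?thesis by simp
  qed
  \<comment> \<open>Only the product \<open>l * t\<close> matters, so it becomes the scale; a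
    negative product exchanges the two points, that is, \<open>p\<close> and
    \<open>1 - p\<close>.\<close>
  consider "t = 0 \<or> l = 0" | "l * t > 0" | "l * t < 0"
    by (metis linorder_neqE_linordered_idom mult_eq_0_iff)
  then show ?thesis
  proof cases
    case 1
    then show ?thesis by auto
  next
    case 2
    then show ?thesis using pos[of "l * t" 1 p] p
      by (simp add: power_mult_distrib algebra_simps)
  next
    case 3
    then show ?thesis using pos[of "- l * t" 1 "1 - p"] p
      by (simp add: power_mult_distrib algebra_simps)
  qed
qed

section \<open>The sketch as a process on tagged lists\<close>

text \<open>
  A state is a list of items tagged with codes: code \<open>0\<close> marks the reservoir item of the current
  block, code \<open>h + 1\<close> an item of level \<open>h\<close>, which has weight \<open>2^h\<close>. The sorting key is a parameter, so
  that the same functions run on positions (the algorithm) and on items (the analysis).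
\<close>

definition compact_level :: "('b \<Rightarrow> 'k::linorder) \<Rightarrow> nat \<Rightarrow> bool \<Rightarrow> (nat \<times> 'b) list \<Rightarrow> (nat \<times> 'b) list" where
  "compact_level key h b zs = filter (\<lambda>z. fst z \<noteq> Suc h) zs @
     map (Pair (Suc (Suc h))) (alternate b (sort_key key (map snd (filter (\<lambda>z. fst z = Suc h) zs))))"

definition offer :: "bool \<Rightarrow> 'b \<Rightarrow> (nat \<times> 'b) list \<Rightarrow> (nat \<times> 'b) list" where
  "offer b y zs = (if b then filter (\<lambda>z. fst z \<noteq> 0) zs @ [(0, y)] else zs)"

definition release :: "nat \<Rightarrow> (nat \<times> 'b) list \<Rightarrow> (nat \<times> 'b) list" where
  "release h = map (\<lambda>z. if fst z = 0 then (Suc h, snd z) else z)"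

text \<open>The stream length is the first word because the epoch, the offset in the block and all
  compaction times are functions of it.\<close>

definition encode :: "nat \<Rightarrow> (nat \<times> 'b) list \<Rightarrow> 'b memory" where
  "encode n zs = (map snd zs, n # map fst zs)"

text \<open>Ranks can be computed from comparison outcomes alone, and they order the positions as
  the hidden items are ordered.\<close>

definition pos_key :: "nat \<Rightarrow> (nat \<Rightarrow> nat \<Rightarrow> bool) \<Rightarrow> nat \<Rightarrow> nat" where
  "pos_key m le p = card {q. q < m \<and> le q p}"

text \<open>Code \<open>0\<close> counts nothing: the reservoir item stands for an unfinished block,
  so the estimate refers to finished blocks only.\<close>

definition est :: "('b \<Rightarrow> bool) \<Rightarrow> (nat \<times> 'b) list \<Rightarrow> nat" where
  "est Q zs = sum_list (map (\<lambda>z. if fst z \<noteq> 0 \<and> Q (snd z) then 2 ^ (fst z - 1) else 0) zs)"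

locale sketch =
  fixes K :: nat
  assumes K2: "2 \<le> K"
begin

text \<open>
  In epoch \<open>H\<close>, for \<open>2^(H - 1 + K) < n \<le> 2^(H + K)\<close>, the levels in use are \<open>base H\<close> to \<open>H\<close>, and
  level \<open>h\<close> is compacted when \<open>period H h\<close> divides \<open>n\<close>. Truncated subtraction makes \<open>base H = 0\<close>
  in the early epochs, where blocks have size \<open>1\<close> and no sampling takes place.
\<close>

definition base :: "nat \<Rightarrow> nat" where
  "base H = H - (2 * K - 2)"

definition block :: "nat \<Rightarrow> nat" where
  "block H = 2 ^ base H"

definition period :: "nat \<Rightarrow> nat \<Rightarrow> nat" where
  "period H h = 2 ^ (h + K - (H - h) div 2)"

definition epoch :: "nat \<Rightarrow> nat" where
  "epoch n = (LEAST H. n \<le> 2 ^ (H + K))"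

primrec cascade ::
    "('b \<Rightarrow> 'k::linorder) \<Rightarrow> nat \<Rightarrow> nat \<Rightarrow> nat list \<Rightarrow> (nat \<times> 'b) list \<Rightarrow> (nat \<times> 'b) list pmf" where
  "cascade key H N [] zs = return_pmf zs"
| "cascade key H N (h # hs) zs =
     (if period H h dvd N
      then bernoulli_pmf (1/2) \<bind> (\<lambda>b. cascade key H N hs (compact_level key h b zs))
      else cascade key H N hs zs)"

definition settle :: "('b \<Rightarrow> 'k::linorder) \<Rightarrow> nat \<Rightarrow> nat \<Rightarrow> (nat \<times> 'b) list \<Rightarrow> (nat \<times> 'b) list pmf" where
  "settle key H N zs = cascade key H N [base H..<Suc H]
     (if block H dvd N then release (base H) zs else zs)"

text \<open>Reservoir sampling: \<open>n mod block H\<close> items of the block have been seen, so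
  this probability keeps the reservoir item uniform. The first item of a block is taken with
  certainty.\<close>

definition step :: "('b \<Rightarrow> 'k::linorder) \<Rightarrow> nat \<Rightarrow> nat \<Rightarrow> 'b \<Rightarrow> (nat \<times> 'b) list \<Rightarrow> (nat \<times> 'b) list pmf" where
  "step key H n y zs =
     bernoulli_pmf (1 / real (Suc (n mod block H))) \<bind> (\<lambda>b. settle key H (Suc n) (offer b y zs))"

definition sketch_update :: "nat \<Rightarrow> (nat \<Rightarrow> nat \<Rightarrow> bool) \<Rightarrow> nat list \<Rightarrow> (nat list \<times> nat list) pmf" where
  "sketch_update m le ws = map_pmf (encode (Suc (hd ws)))
     (step (pos_key m le) (epoch (Suc (hd ws))) (hd ws) (m - 1) (zip (tl ws) [0..<m - 1]))"

definition sketch_answer :: "(nat \<Rightarrow> real pmf) \<Rightarrow> nat \<Rightarrow> (nat \<Rightarrow> nat \<Rightarrow> bool) \<Rightarrow> nat list \<Rightarrow> real pmf" where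
  "sketch_answer noise m le ws =
     map_pmf ((+) (real (est (\<lambda>p. le p (m - 1)) (zip (tl ws) [0..<m - 1])))) (noise (hd ws))"

definition sketch_alg :: "(nat \<Rightarrow> real pmf) \<Rightarrow> streaming_alg" where
  "sketch_alg noise = \<lparr>init_words = [0], update = sketch_update, answer = sketch_answer noise\<rparr>"

definition states :: "'a::linorder list \<Rightarrow> (nat \<times> 'a) list pmf" where
  "states xs = foldl (\<lambda>p (n, x). p \<bind> step (\<lambda>x. x) (epoch (Suc n)) n x) (return_pmf []) (List.enumerate 0 xs)"

lemma states_Nil [simp]: "states [] = return_pmf []"
  by (simp add: states_def)

lemma states_snoc:
  "states (xs @ [x]) = states xs \<bind> step (\<lambda>x. x) (epoch (Suc (length xs))) (length xs) x"
  by (simp add: states_def enumerate_append_eq)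

end

subsection \<open>From positions to items\<close>

text \<open>A sorted list is determined by its multiset, so the way in which either sort breaks ties
  is invisible after mapping.\<close>

lemma map_sort_key:
  fixes g :: "'b \<Rightarrow> 'a::linorder" and key :: "'b \<Rightarrow> 'k::linorder"
  assumes "\<And>p q. p \<in> set ps \<Longrightarrow> q \<in> set ps \<Longrightarrow> key p \<le> key q \<Longrightarrow> g p \<le> g q"
  shows "map g (sort_key key ps) = sort_key (\<lambda>x. x) (map g ps)"
proof -
  have "sorted (map g (sort_key key ps))"
    unfolding sorted_map
    by (rule sorted_wrt_mono_rel[OF _ sorted_sort_key[of key ps, unfolded sorted_map]])
       (use assms in auto)
  then show ?thesis by (intro properties_for_sort[symmetric]) auto
qed

lemma map_compact:
  fixes g :: "'b \<Rightarrow> 'a::linorder" and key :: "'b \<Rightarrow> 'k::linorder"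
  assumes "\<And>p q. p \<in> B \<Longrightarrow> q \<in> B \<Longrightarrow> key p \<le> key q \<Longrightarrow> g p \<le> g q" and "snd ` set zs \<subseteq> B"
  shows "map (apsnd g) (compact_level key h b zs) = compact_level (\<lambda>x. x) h b (map (apsnd g) zs)"
proof -
  have "map g (sort_key key (map snd (filter (\<lambda>z. fst z = Suc h) zs)))
     = sort_key (\<lambda>x. x) (map g (map snd (filter (\<lambda>z. fst z = Suc h) zs)))"
    using assms(2) by (intro map_sort_key assms(1)) auto
  from arg_cong[OF this, of "map (Pair (Suc (Suc h))) \<circ> alternate b"] show ?thesis
    by (simp add: compact_level_def filter_map o_def map_alternate[of g, symmetric])
qed

lemma set_alternate: "set (alternate b xs) \<subseteq> set xs"
  by (induction b xs rule: alternate.induct) auto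

lemma set_compact: "snd ` set (compact_level key h b zs) \<subseteq> snd ` set zs"
  by (auto simp: compact_level_def dest!: subsetD[OF set_alternate])

lemma set_release: "snd ` set (release h zs) = snd ` set zs"
proof -
  have "map snd (release h zs) = map snd zs" by (simp add: release_def)
  then show ?thesis by (metis list.set_map)
qed

context sketch
begin

lemma map_cascade:
  fixes g :: "'b \<Rightarrow> 'a::linorder" and key :: "'b \<Rightarrow> 'k::linorder"
  assumes "\<And>p q. p \<in> B \<Longrightarrow> q \<in> B \<Longrightarrow> key p \<le> key q \<Longrightarrow> g p \<le> g q" and "snd ` set zs \<subseteq> B"
  shows "map_pmf (map (apsnd g)) (cascade key H N hs zs) = cascade (\<lambda>x. x) H N hs (map (apsnd g) zs)"
  using assms(2)
proof (induction hs arbitrary: zs)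
  case (Cons h hs)
  have "snd ` set (compact_level key h b zs) \<subseteq> B" for b
    by (rule order_trans[OF set_compact Cons.prems])
  moreover have "map (apsnd g) (compact_level key h b zs) = compact_level (\<lambda>x. x) h b (map (apsnd g) zs)" for b
    by (rule map_compact[OF assms(1) Cons.prems])
  ultimately show ?case
    using Cons by (simp add: map_bind_pmf)
qed simp

lemma set_cascade: "qs \<in> set_pmf (cascade key H N hs zs) \<Longrightarrow> snd ` set qs \<subseteq> snd ` set zs"
proof (induction hs arbitrary: zs)
  case (Cons h hs)
  show ?case
  proof (cases "period H h dvd N")
    case True
    with Cons.prems obtain b where "qs \<in> set_pmf (cascade key H N hs (compact_level key h b zs))"
      by auto
    from Cons.IH[OF this] set_compact show ?thesis by (rule order_trans)
  next
    case False
    with Cons show ?thesis by simp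
  qed
qed simp

lemma map_step:
  fixes g :: "'b \<Rightarrow> 'a::linorder" and key :: "'b \<Rightarrow> 'k::linorder"
  assumes mono: "\<And>p q. p \<in> B \<Longrightarrow> q \<in> B \<Longrightarrow> key p \<le> key q \<Longrightarrow> g p \<le> g q"
    and zs: "snd ` set zs \<subseteq> B" and y: "y \<in> B"
  shows "map_pmf (map (apsnd g)) (step key H n y zs) = step (\<lambda>x. x) H n (g y) (map (apsnd g) zs)"
proof -
  have 1: "map (apsnd g) (offer b y zs) = offer b (g y) (map (apsnd g) zs)" for b
    by (simp add: offer_def filter_map o_def)
  have 2: "map (apsnd g) (release h zs) = release h (map (apsnd g) zs)" for h zs
    by (simp add: release_def o_def if_distrib[of "apsnd g"] cong: if_cong)
  have 3: "snd ` set (offer b y zs) \<subseteq> B" for b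
    using zs y by (auto simp: offer_def)
  show ?thesis
    using 3 by (simp add: set_release step_def settle_def map_bind_pmf map_cascade[OF mono] 1 2 if_distrib[of "map (apsnd g)"] cong: if_cong del: upt_Suc)
qed

text \<open>The bridge from the comparison model to the analysis: the update sees only positions and
  comparisons, yet reading off the chosen items gives exactly one step on items.\<close>

lemma process_item_sketch:
  fixes x :: "'a::linorder"
  shows "process_item (sketch_alg noise) x (encode n zs)
    = map_pmf (encode (Suc n)) (step (\<lambda>x. x) (epoch (Suc n)) n x zs)"
proof -
  define ys where "ys = map snd zs @ [x]"
  let ?m = "length zs" and ?key = "pos_key (Suc (length zs)) (item_le ys)"
  define ps where "ps = zip (map fst zs) [0..<?m]"
  \<comment> \<open>If the item at \<open>p\<close> is strictly larger than the one at
    \<open>q\<close>, the positions counted for \<open>q\<close> are counted for \<open>p\<close>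
    too, and \<open>p\<close> itself is an extra one.\<close>
  have mono: "ys ! p \<le> ys ! q"
    if "p \<in> {..?m}" "q \<in> {..?m}" and le: "?key p \<le> ?key q" for p q
  proof (rule ccontr)
    assume less: "\<not> ys ! p \<le> ys ! q"
    have "p \<in> {r. r < Suc ?m \<and> item_le ys r p}" "p \<notin> {r. r < Suc ?m \<and> item_le ys r q}"
      using that less by (auto simp: item_le_def ys_def)
    moreover have "{r. r < Suc ?m \<and> item_le ys r q} \<subseteq> {r. r < Suc ?m \<and> item_le ys r p}"
      using that less by (auto simp: item_le_def ys_def)
    ultimately have "{r. r < Suc ?m \<and> item_le ys r q} \<subset> {r. r < Suc ?m \<and> item_le ys r p}"
      by blast
    then have "?key q < ?key p" unfolding pos_key_def by (intro psubset_card_mono) auto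
    with le show False by simp
  qed
  have ps: "map (apsnd ((!) ys)) ps = zs"
    by (rule nth_equalityI) (simp_all add: ps_def ys_def nth_append)
  have sub: "snd ` set ps \<subseteq> {..?m}" by (auto simp: ps_def dest: set_zip_rightD)
  \<comment> \<open>All chosen positions are valid, so \<open>select_items\<close> drops nothing and
    the items stay aligned with their codes.\<close>
  have inB: "snd ` set qs \<subseteq> {..?m}"
    if mem: "qs \<in> set_pmf (step ?key H n ?m ps)" for qs H
  proof -
    obtain b where qs: "qs \<in> set_pmf (settle ?key H (Suc n) (offer b ?m ps))"
      using mem unfolding step_def set_bind_pmf by blast
    have "snd ` set qs \<subseteq> snd ` set (offer b ?m ps)"
      using set_cascade[OF qs[unfolded settle_def]] by (simp add: set_release split: if_splits)
    also have "\<dots> \<subseteq> {..?m}"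
      using sub by (auto simp: offer_def)
    finally show ?thesis .
  qed
  have sel: "(select_items ys (map snd qs), Suc n # map fst qs) = encode (Suc n) (map (apsnd ((!) ys)) qs)"
    if "snd ` set qs \<subseteq> {..?m}" for qs
  proof -
    have "filter (\<lambda>j. j < length ys) (map snd qs) = map snd qs"
      using that by (auto simp: filter_id_conv ys_def)
    then show ?thesis by (simp add: select_items_def encode_def o_def)
  qed
  have "process_item (sketch_alg noise) x (encode n zs)
      = map_pmf (\<lambda>qs. (select_items ys (map snd qs), Suc n # map fst qs)) (step ?key (epoch (Suc n)) n ?m ps)"
    by (simp add: process_item_def encode_def sketch_alg_def sketch_update_def ys_def ps_def
        map_pmf_comp split: prod.splits)
  also have "\<dots> = map_pmf (\<lambda>qs. encode (Suc n) (map (apsnd ((!) ys)) qs)) (step ?key (epoch (Suc n)) n ?m ps)"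
    using inB sel by (intro map_pmf_cong) blast+
  also have "\<dots> = map_pmf (encode (Suc n)) (map_pmf (map (apsnd ((!) ys))) (step ?key (epoch (Suc n)) n ?m ps))"
    by (simp add: map_pmf_comp)
  also have "map_pmf (map (apsnd ((!) ys))) (step ?key (epoch (Suc n)) n ?m ps)
     = step (\<lambda>x. x) (epoch (Suc n)) n (ys ! ?m) (map (apsnd ((!) ys)) ps)"
    by (rule map_step[OF mono sub]) auto
  finally show ?thesis by (simp add: ps) (simp add: ys_def nth_append)
qed

lemma run_stream_sketch: "run_stream (sketch_alg noise) xs = map_pmf (encode (length xs)) (states xs)"
proof (induction xs rule: rev_induct)
  case Nil
  then show ?case by (simp add: run_stream_def sketch_alg_def encode_def)
next
  case (snoc x xs)
  have "run_stream (sketch_alg noise) (xs @ [x]) = run_stream (sketch_alg noise) xs \<bind> process_item (sketch_alg noise) x"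
    by (simp add: run_stream_def)
  then show ?case
    by (simp add: snoc states_snoc bind_map_pmf map_bind_pmf process_item_sketch)
qed

lemma query_output_sketch:
  "query_output (sketch_alg noise) xs x =
     states xs \<bind> (\<lambda>zs. map_pmf ((+) (real (est (\<lambda>y. y \<le> x) zs))) (noise (length xs)))"
proof -
  have "est (\<lambda>p. item_le (map snd zs @ [x]) p (length zs)) (zip (map fst zs) [0..<length zs])
      = est (\<lambda>y. y \<le> x) zs" for zs
  proof -
    have "map (\<lambda>z. if fst z \<noteq> 0 \<and> item_le (map snd zs @ [x]) (snd z) (length zs) then 2 ^ (fst z - 1) else 0 :: nat) (zip (map fst zs) [0..<length zs])
      = map (\<lambda>z. if fst z \<noteq> 0 \<and> snd z \<le> x then 2 ^ (fst z - 1) else 0) zs"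
      by (rule nth_equalityI) (auto simp: item_le_def nth_append)
    then show ?thesis unfolding est_def by (rule arg_cong)
  qed
  then show ?thesis
    unfolding query_output_def run_stream_sketch bind_map_pmf
    by (simp add: encode_def sketch_alg_def sketch_answer_def)
qed

end

subsection \<open>Buffer sizes\<close>

definition code_count :: "nat \<Rightarrow> (nat \<times> 'b) list \<Rightarrow> nat" where
  "code_count c zs = length (filter (\<lambda>z. fst z = c) zs)"

definition weight_below :: "nat \<Rightarrow> (nat \<times> 'b) list \<Rightarrow> nat" where
  "weight_below b zs = (\<Sum>h<b. code_count (Suc h) zs * 2 ^ h)"

lemma code_count_simps [simp]:
  "code_count c [] = 0"
  "code_count c (z # zs) = (if fst z = c then 1 else 0) + code_count c zs"
  "code_count c (xs @ ys) = code_count c xs + code_count c ys"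
  "code_count c (map (Pair d) us) = (if c = d then length us else 0)"
  by (auto simp: code_count_def filter_map o_def)

lemma code_count_filter: "code_count c (filter (\<lambda>z. fst z \<noteq> d) zs) = (if c = d then 0 else code_count c zs)"
  by (auto simp: code_count_def filter_empty_conv intro!: arg_cong[of _ _ length] filter_cong)

lemma code_count_compact:
  assumes "even (code_count (Suc h) zs)"
  shows "code_count c (compact_level key h b zs) =
    (if c = Suc h then 0 else if c = Suc (Suc h) then code_count c zs + code_count (Suc h) zs div 2
     else code_count c zs)"
  using length_alternate[of "sort_key key (map snd (filter (\<lambda>z. fst z = Suc h) zs))" b] assms
  by (auto simp: compact_level_def code_count_filter) (auto simp: code_count_def)

lemma weight_below_Suc: "weight_below (Suc b) zs = weight_below b zs + code_count (Suc b) zs * 2 ^ b"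
  by (simp add: weight_below_def)

text \<open>Two items of weight \<open>2 ^ h\<close> become one of weight
  \<open>2 ^ (h + 1)\<close>, so weight crosses only the cut between levels \<open>h\<close> and
  \<open>h + 1\<close>.\<close>

lemma weight_below_compact:
  assumes ev: "even (code_count (Suc h) zs)"
  shows "weight_below b (compact_level key h c zs) = (if b = Suc h then weight_below h zs else weight_below b zs)"
proof -
  let ?zs = "compact_level key h c zs"
  have le: "weight_below b ?zs = weight_below b zs" if "b \<le> h" for b
    unfolding weight_below_def using that by (intro sum.cong) (auto simp: code_count_compact[OF ev])
  have ge: "weight_below b ?zs = weight_below b zs" if "Suc (Suc h) \<le> b" for b
    using that
  proof (induction b rule: dec_induct)
    case base
    from ev obtain k where "code_count (Suc h) zs = 2 * k" by blast
    then show ?case using le[of h] by (simp add: weight_below_Suc code_count_compact[OF ev] algebra_simps)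
  next
    case (step b)
    then show ?case by (simp add: weight_below_Suc code_count_compact[OF ev])
  qed
  consider "b \<le> h" | "b = Suc h" | "Suc (Suc h) \<le> b" by linarith
  then show ?thesis
  proof cases
    case 2
    then show ?thesis using le[of h] by (simp add: weight_below_Suc code_count_compact[OF ev])
  qed (use le ge in auto)
qed

lemma weight_below_mono: "b \<le> c \<Longrightarrow> weight_below b zs \<le> weight_below c zs"
  unfolding weight_below_def by (rule sum_mono2) auto

lemma code_count_offer:
  "code_count c (offer b y zs) = (if c = 0 \<and> b then 1 else code_count c zs)"
  by (cases b) (simp_all add: offer_def code_count_filter[of _ 0, simplified])

lemma code_count_release:
  "code_count c (release h zs) =
     (if c = 0 then 0 else if c = Suc h then code_count c zs + code_count 0 zs else code_count c zs)"
  by (induction zs) (auto simp: release_def)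

lemma weight_below_offer [simp]: "weight_below b (offer c y zs) = weight_below b zs"
  by (simp add: weight_below_def code_count_offer)

lemma weight_below_release:
  "weight_below b (release h zs) = weight_below b zs + (if h < b then code_count 0 zs * 2 ^ h else 0)"
proof (induction b)
  case (Suc b)
  then show ?case by (auto simp: weight_below_Suc code_count_release algebra_simps)
qed (simp add: weight_below_def)

lemma length_eq_sum_code_count:
  assumes "\<forall>z\<in>set zs. fst z < C"
  shows "length zs = (\<Sum>c<C. code_count c zs)"
  using assms
proof (induction zs)
  case (Cons z zs)
  have "(\<Sum>c<C. code_count c (z # zs)) = (\<Sum>c<C. (if fst z = c then 1 else 0) + code_count c zs)"
    by (intro sum.cong) (auto simp: code_count_def)
  then show ?case using Cons by (simp add: sum.distrib)
qed simp

text \<open>A geometric series with every exponent taken twice; it sums the capacities of the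
  levels.\<close>

lemma sum_half_powers: "(\<Sum>d<D. (1/2::real) ^ (d div 2)) \<le> 4"
proof -
  have "(\<Sum>d<2*m. (1/2::real) ^ (d div 2)) = 4 - 4 * (1/2) ^ m" for m
    by (induction m) (auto simp: algebra_simps)
  moreover have "(\<Sum>d<D. (1/2::real) ^ (d div 2)) \<le> (\<Sum>d<2*D. (1/2::real) ^ (d div 2))"
    by (intro sum_mono2) auto
  ultimately show ?thesis by (smt (verit) zero_le_power zero_le_divide_1_iff)
qed

text \<open>The exponent is \<open>d / 2\<close> rounded up, so \<open>0\<close> occurs once and
  other values twice; this sums the variances of the levels.\<close>

lemma sum_half_powers_ceiling: "(\<Sum>d<D. (1/2::real) ^ (d - d div 2)) \<le> 3"
proof -
  have "(\<Sum>d<Suc (2*m). (1/2::real) ^ (d - d div 2)) = 3 - 2 * (1/2) ^ m" for m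
  proof (induction m)
    case (Suc m)
    have "Suc (2 * m) - Suc (2 * m) div 2 = Suc m" "Suc (Suc (2 * m)) - Suc (Suc (2 * m)) div 2 = Suc m" by auto
    then show ?case using Suc by (simp add: algebra_simps)
  qed simp
  moreover have "(\<Sum>d<D. (1/2::real) ^ (d - d div 2)) \<le> (\<Sum>d<Suc (2*D). (1/2::real) ^ (d - d div 2))"
    by (intro sum_mono2) auto
  ultimately show ?thesis by (smt (verit) zero_le_power zero_le_divide_1_iff)
qed

text \<open>Expectation of the test function when the reservoir item is uniform on
  \<open>ys\<close>. An empty block has no reservoir item, hence the default
  \<open>f False\<close>.\<close>

definition block_average :: "('a \<Rightarrow> bool) \<Rightarrow> 'a list \<Rightarrow> (bool \<Rightarrow> real) \<Rightarrow> real" where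
  "block_average Q ys f = (if ys = [] then f False else
     (real (length (filter Q ys)) * f True + (real (length ys) - real (length (filter Q ys))) * f False) / real (length ys))"

text \<open>One step of reservoir sampling: accepting \<open>y\<close> with probability
  \<open>1 / (length ys + 1)\<close> turns a uniform item of \<open>ys\<close> into a uniform item
  of \<open>ys @ [y]\<close>.\<close>

lemma block_average_snoc:
  "block_average Q ys (\<lambda>b. (f (Q y) + real (length ys) * f b) / real (Suc (length ys))) = block_average Q (ys @ [y]) f"
proof (cases "ys = []")
  case True
  then show ?thesis by (auto simp: block_average_def)
next
  case False
  define r i where "r = real (length (filter Q ys))" and "i = real (length ys)"
  have "i > 0" using False by (simp add: i_def)
  then have "(r * ((f (Q y) + i * f True) / (1 + i)) + (i - r) * ((f (Q y) + i * f False) / (1 + i))) / i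
    = (f (Q y) + r * f True + (i - r) * f False) / (1 + i)"
    by (simp add: divide_simps) (simp add: algebra_simps)
  then show ?thesis using False by (simp add: block_average_def r_def[symmetric] i_def[symmetric] algebra_simps)
qed

lemma Suc_mod: "Suc n mod P = (if P dvd Suc n then 0 else Suc (n mod P))"
  using mod_Suc[of n P] by (auto simp: dvd_eq_mod_eq_0)

lemma Suc_mod_dvd: "P dvd Suc n \<Longrightarrow> Suc (n mod P) = P"
  using mod_Suc[of n P] by (auto simp: dvd_eq_mod_eq_0 split: if_splits)

section \<open>Arithmetic of epochs, blocks and periods\<close>

context sketch
begin

lemma epoch_ge: "n \<le> 2 ^ (epoch n + K)"
  unfolding epoch_def
proof (rule LeastI_ex)
  have "n \<le> 2 ^ n" by (simp add: less_imp_le)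
  also have "\<dots> \<le> (2::nat) ^ (n + K)" by (intro power_increasing) auto
  finally show "\<exists>H. n \<le> 2 ^ (H + K)" by blast
qed

lemma epoch_least: "n \<le> 2 ^ (H + K) \<Longrightarrow> epoch n \<le> H"
  unfolding epoch_def by (rule Least_le)

lemma epoch_gt: "H < epoch n \<Longrightarrow> 2 ^ (H + K) < n"
  using epoch_least[of n H] by force

lemma epoch_0 [simp]: "epoch 0 = 0"
  using epoch_least[of 0 0] by simp

lemma epoch_le_self: "epoch n \<le> n"
proof (rule epoch_least)
  have "n \<le> 2 ^ n" by (simp add: less_imp_le)
  also have "\<dots> \<le> (2::nat) ^ (n + K)" by (intro power_increasing) auto
  finally show "n \<le> 2 ^ (n + K)" .
qed

lemma epoch_Suc_cases:
  obtains "epoch (Suc n) = epoch n" | "n = 2 ^ (epoch n + K)" "epoch (Suc n) = Suc (epoch n)"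
proof (cases "n = 2 ^ (epoch n + K)")
  case True
  have "\<not> epoch (Suc n) \<le> epoch n"
  proof
    assume "epoch (Suc n) \<le> epoch n"
    then have "(2::nat) ^ (epoch (Suc n) + K) \<le> 2 ^ (epoch n + K)" by (intro power_increasing) auto
    then show False using epoch_ge[of "Suc n"] True by linarith
  qed
  moreover have "epoch (Suc n) \<le> Suc (epoch n)"
  proof (rule epoch_least)
    have "(1::nat) \<le> 2 ^ (epoch n + K)" by simp
    then show "Suc n \<le> 2 ^ (Suc (epoch n) + K)" using True by simp
  qed
  ultimately show ?thesis using that(2) True by simp
next
  case False
  then have "Suc n \<le> 2 ^ (epoch n + K)" using epoch_ge[of n] by simp
  then have "epoch (Suc n) \<le> epoch n" by (rule epoch_least)
  moreover have "epoch n \<le> epoch (Suc n)"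
    by (rule epoch_least) (use epoch_ge[of "Suc n"] in simp)
  ultimately show ?thesis using that(1) by simp
qed

lemma base_le: "base H \<le> H" by (simp add: base_def)

text \<open>The choice of \<open>base\<close> keeps \<open>(H - h) div 2\<close> at most
  \<open>K - 1\<close>, so every capacity is a power of two and at least \<open>2\<close>. Hence
  full buffers have even length.\<close>

lemma period_exponent:
  assumes "base H \<le> h" "h \<le> H"
  shows "Suc h \<le> h + K - (H - h) div 2"
  using assms K2 by (auto simp: base_def)

lemma block_dvd_period: "base H \<le> h \<Longrightarrow> h \<le> H \<Longrightarrow> block H dvd period H h"
  unfolding block_def period_def using period_exponent[of H h] by (intro le_imp_power_dvd) auto

lemma level_dvd_period: "base H \<le> h \<Longrightarrow> h \<le> H \<Longrightarrow> 2 ^ Suc h dvd period H h"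
  unfolding period_def using period_exponent[of H h] by (intro le_imp_power_dvd) auto

lemma period_dvd_Suc: "base H \<le> h \<Longrightarrow> h < H \<Longrightarrow> period H h dvd period H (Suc h)"
  unfolding period_def by (intro le_imp_power_dvd) auto

lemma period_top: "period H H = 2 ^ (H + K)"
  by (simp add: period_def)

lemma period_Suc_dvd: "h \<le> H \<Longrightarrow> period (Suc H) h dvd 2 ^ (H + K)"
  unfolding period_def by (intro le_imp_power_dvd) auto

lemma block_dvd_top: "block H dvd 2 ^ (H + K)"
  unfolding block_def by (intro le_imp_power_dvd) (auto simp: base_def)

lemma block_Suc_dvd_top: "block (Suc H) dvd 2 ^ (H + K)"
  unfolding block_def using K2 by (intro le_imp_power_dvd) (auto simp: base_def)

section \<open>The invariant of the schedule\<close>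

text \<open>
  The state after \<open>n\<close> items when the cascade has handled the levels below \<open>j\<close>: the weight up to a
  handled level, plus the pending part of the block, is the residue of \<open>n\<close> modulo the period. For the
  other levels the residue has not been reduced yet, hence the shape \<open>Suc ((n - 1) mod _)\<close>.
\<close>

definition progress :: "nat \<Rightarrow> nat \<Rightarrow> nat \<Rightarrow> (nat \<times> 'b) list \<Rightarrow> bool" where
  "progress H n j zs \<longleftrightarrow>
     (\<forall>z\<in>set zs. fst z \<le> H + 2) \<and>
     code_count 0 zs = (if block H dvd n then 0 else 1) \<and>
     weight_below (base H) zs = 0 \<and>
     (\<forall>h. base H \<le> h \<longrightarrow> h \<le> H \<longrightarrow> weight_below (Suc h) zs + n mod block H =
        (if h < j then n mod period H h else Suc ((n - 1) mod period H h))) \<and>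
     weight_below (H + 2) zs + n mod block H = n"

abbreviation "balanced H n \<equiv> progress H n (Suc H)"

lemma progress_skip:
  assumes "progress H (Suc n) j zs" "\<not> period H j dvd Suc n"
  shows "progress H (Suc n) (Suc j) zs"
  using assms unfolding progress_def by (auto simp: less_Suc_eq Suc_mod)

text \<open>Periods divide each other upwards, so when level \<open>j\<close> is due, the levels
  below it are empty and it holds weight exactly \<open>period H j\<close>. This is an even number
  of items, so no weight is lost.\<close>

lemma progress_compact:
  assumes inv: "progress H (Suc n) j zs" and per: "period H j dvd Suc n" and j: "base H \<le> j" "j \<le> H"
  shows "progress H (Suc n) (Suc j) (compact_level key j b zs)"
proof -
  have blk: "Suc n mod block H = 0"
    using dvd_trans[OF block_dvd_period[OF j] per] by (rule dvd_imp_mod_0)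
  have levels: "weight_below (Suc h) zs =
        (if h < j then Suc n mod period H h else Suc (n mod period H h))" if "base H \<le> h" "h \<le> H" for h
    using inv that blk unfolding progress_def by simp
  have w: "weight_below (Suc j) zs = period H j"
    using levels[OF j] Suc_mod_dvd[OF per] by simp
  have w0: "weight_below j zs = 0"
  proof (cases "j = base H")
    case True
    then show ?thesis using inv unfolding progress_def by simp
  next
    case False
    then have j': "base H \<le> j - 1" "j - 1 < H" "Suc (j - 1) = j" using j by auto
    from period_dvd_Suc[OF j'(1,2)] j'(3) per have "period H (j - 1) dvd Suc n"
      by (simp add: dvd_trans[of _ "period H j"])
    then show ?thesis using levels[of "j - 1"] j' by simp
  qed
  have "code_count (Suc j) zs * 2 ^ j = period H j" using w w0 by (simp add: weight_below_Suc)
  with level_dvd_period[OF j] have "2 * 2 ^ j dvd code_count (Suc j) zs * 2 ^ j" by simp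
  then have ev: "even (code_count (Suc j) zs)" using dvd_times_right_cancel_iff[of "2 ^ j" 2 "code_count (Suc j) zs"] by simp
  have codes: "\<forall>z\<in>set (compact_level key j b zs). fst z \<le> H + 2"
    using inv j unfolding progress_def compact_level_def by auto
  have c0: "code_count 0 (compact_level key j b zs) = code_count 0 zs"
    by (simp add: code_count_compact[OF ev])
  have wb: "weight_below c (compact_level key j b zs) = (if c = Suc j then 0 else weight_below c zs)" for c
    by (simp add: weight_below_compact[OF ev] w0)
  have *: "weight_below (Suc h) (compact_level key j b zs) + Suc n mod block H =
        (if h < Suc j then Suc n mod period H h else Suc (n mod period H h))"
    if "base H \<le> h" "h \<le> H" for h
    using levels[OF that] blk per by (auto simp: wb less_Suc_eq)
  show ?thesis
    using inv codes c0 * j unfolding progress_def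
    by (simp add: wb)
qed

lemma progress_cascade:
  assumes "progress H (Suc n) j zs" "base H \<le> j" "j \<le> Suc H"
    and "zs' \<in> set_pmf (cascade key H (Suc n) [j..<Suc H] zs)"
  shows "balanced H (Suc n) zs'"
  using assms
proof (induction "Suc H - j" arbitrary: j zs)
  case 0
  then show ?case by simp
next
  case (Suc d)
  then have j: "j \<le> H" and upt: "[j..<Suc H] = j # [Suc j..<Suc H]" by (auto simp: upt_conv_Cons simp del: upt_Suc)
  show ?case
  proof (cases "period H j dvd Suc n")
    case True
    with Suc.prems(4) upt obtain b where "zs' \<in> set_pmf (cascade key H (Suc n) [Suc j..<Suc H] (compact_level key j b zs))"
      by (auto simp del: upt_Suc)
    then show ?thesis
      using Suc.hyps(2) Suc.prems(2) j by (intro Suc.hyps(1)[OF _ progress_compact[OF Suc.prems(1) True]]) auto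
  next
    case False
    with Suc.prems(4) upt have "zs' \<in> set_pmf (cascade key H (Suc n) [Suc j..<Suc H] zs)"
      by (auto simp del: upt_Suc)
    then show ?thesis
      using Suc.hyps(2) Suc.prems(2) j by (intro Suc.hyps(1)[OF _ progress_skip[OF Suc.prems(1) False]]) auto
  qed
qed

lemma balanced_step:
  assumes bal: "balanced H n zs" and n: "n < 2 ^ (H + K)" and zs': "zs' \<in> set_pmf (step key H n y zs)"
  shows "balanced H (Suc n) zs'"
proof -
  let ?s = "block H"
  obtain b where b: "b \<in> set_pmf (bernoulli_pmf (1 / real (Suc (n mod ?s))))"
    and zs'': "zs' \<in> set_pmf (settle key H (Suc n) (offer b y zs))"
    using zs' unfolding step_def set_bind_pmf by blast
  define us where "us = offer b y zs"
  \<comment> \<open>At the start of a block the acceptance probability is \<open>1\<close>, so a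
    rejection implies that a reservoir item is already there.\<close>
  have c0: "code_count 0 us = 1"
  proof (cases b)
    case False
    then have "n mod ?s \<noteq> 0" using b by (cases "n mod ?s = 0") (auto simp: set_pmf_iff)
    then show ?thesis using bal False unfolding progress_def us_def
      by (auto simp: code_count_offer)
  qed (simp add: us_def code_count_offer)
  have levels: "weight_below (Suc h) us + n mod ?s = n mod period H h" if "base H \<le> h" "h \<le> H" for h
    using bal that unfolding progress_def us_def by simp
  have codes: "\<forall>z\<in>set us. fst z \<le> H + 2"
    using bal unfolding progress_def us_def offer_def by auto
  have w: "weight_below (base H) us = 0" "weight_below (H + 2) us + n mod ?s = n"
    using bal unfolding progress_def us_def by auto
  have "progress H (Suc n) (base H) (if ?s dvd Suc n then release (base H) us else us)"
  proof (cases "?s dvd Suc n")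
    case True
    have s: "Suc (n mod ?s) = ?s" using Suc_mod_dvd[OF True] .
    have "weight_below (Suc h) us + ?s = Suc (n mod period H h)" if "base H \<le> h" "h \<le> H" for h
      using levels[OF that] s by linarith
    moreover have "weight_below (H + 2) us + ?s = Suc n" using w s by linarith
    moreover have "\<forall>z\<in>set (release (base H) us). fst z \<le> H + 2"
      using codes base_le[of H] by (auto simp: release_def)
    ultimately show ?thesis
      using True w(1) base_le[of H] unfolding progress_def
      by (auto simp: c0 code_count_release weight_below_release block_def[symmetric])
  next
    case False
    then show ?thesis
      using codes levels w c0 unfolding progress_def by (auto simp: Suc_mod)
  qed
  then show ?thesis
    using zs'' base_le[of H] unfolding settle_def us_def
    by (intro progress_cascade[of H n "base H" _ zs' key]) (auto simp del: upt_Suc)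
qed

text \<open>At this length the period of level \<open>H\<close> is the length itself, so the cascade
  has moved all weight to level \<open>H + 1\<close>. That is the top level of the next epoch, whose
  period is twice the length; the residues of the lower levels vanish.\<close>

lemma balanced_epoch_Suc:
  assumes bal: "balanced H (2 ^ (H + K)) zs"
  shows "balanced (Suc H) (2 ^ (H + K)) zs"
proof -
  let ?n = "2 ^ (H + K) :: nat"
  have blk: "?n mod block H = 0" "?n mod block (Suc H) = 0"
    using block_dvd_top block_Suc_dvd_top by auto
  have codes: "fst z \<le> H + 2" if "z \<in> set zs" for z
    using bal that unfolding progress_def by blast
  have top: "weight_below (Suc H) zs = 0" and all: "weight_below (H + 2) zs = ?n"
    using bal blk base_le[of H] unfolding progress_def by (auto simp: period_top)
  have zero: "weight_below b zs = 0" if "b \<le> Suc H" for b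
    using weight_below_mono[OF that, of zs] top by simp
  have "code_count (H + 3) zs = 0" using codes by (fastforce simp: code_count_def filter_empty_conv)
  then have "weight_below (H + 3) zs = ?n"
    using all weight_below_Suc[of "H + 2" zs] by (simp add: numeral_3_eq_3)
  moreover have "weight_below (Suc h) zs = ?n mod period (Suc H) h" if "h \<le> Suc H" for h
  proof (cases "h = Suc H")
    case True
    then show ?thesis using all by (simp add: period_top)
  next
    case False
    then show ?thesis using that zero[of "Suc h"] period_Suc_dvd[of h H] by simp
  qed
  moreover have "code_count 0 zs = 0" using bal block_dvd_top unfolding progress_def by auto
  moreover have "weight_below (base (Suc H)) zs = 0" by (intro zero base_le)
  ultimately show ?thesis
    using blk codes block_Suc_dvd_top unfolding progress_def by (fastforce simp: numeral_3_eq_3)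
qed

lemma balanced_Nil: "balanced 0 0 []"
  by (simp add: progress_def weight_below_def)

lemma balanced_next_epoch:
  assumes "balanced (epoch n) n zs"
  shows "balanced (epoch (Suc n)) n zs"
proof (cases rule: epoch_Suc_cases[of n])
  case 2
  have "balanced (epoch n) (2 ^ (epoch n + K)) zs" using assms 2(1) by simp
  then have "balanced (Suc (epoch n)) (2 ^ (epoch n + K)) zs" by (rule balanced_epoch_Suc)
  then show ?thesis using 2 by simp
qed (use assms in simp)

lemma balanced_states: "zs \<in> set_pmf (states xs) \<Longrightarrow> balanced (epoch (length xs)) (length xs) zs"
proof (induction xs arbitrary: zs rule: rev_induct)
  case Nil
  then show ?case by (simp add: balanced_Nil)
next
  case (snoc x xs)
  let ?n = "length xs"
  from snoc.prems obtain us where us: "us \<in> set_pmf (states xs)"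
    and zs: "zs \<in> set_pmf (step (\<lambda>x. x) (epoch (Suc ?n)) ?n x us)"
    unfolding states_snoc by auto
  have "?n < 2 ^ (epoch (Suc ?n) + K)" using epoch_ge[of "Suc ?n"] by simp
  from balanced_step[OF balanced_next_epoch[OF snoc.IH[OF us]] this zs] show ?case by simp
qed

section \<open>Space and word size\<close>

text \<open>A level holds at most its period divided by the weight of its items, and these
  capacities sum to at most \<open>4 * 2 ^ K\<close>. The reservoir item and level
  \<open>H + 1\<close>, bounded through \<open>n\<close>, account for the rest.\<close>

lemma balanced_length:
  assumes bal: "balanced H n zs" and n: "n \<le> 2 ^ (H + K)"
  shows "real (length zs) \<le> 6 * 2 ^ K"
proof -
  have codes: "\<forall>z\<in>set zs. fst z < H + 3" using bal unfolding progress_def by force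
  have zero: "code_count (Suc h) zs = 0" if "h < base H" for h
    using bal that unfolding progress_def weight_below_def by auto
  have lev: "real (code_count (Suc h) zs) \<le> 2 ^ K * (1/2) ^ ((H - h) div 2)" if h: "base H \<le> h" "h \<le> H" for h
  proof -
    have e: "(H - h) div 2 \<le> K" using h K2 by (auto simp: base_def)
    have "code_count (Suc h) zs * 2 ^ h \<le> weight_below (Suc h) zs" by (simp add: weight_below_Suc)
    also have "\<dots> \<le> n mod period H h" using bal h unfolding progress_def
      by (metis le_add1 le_imp_less_Suc)
    also have "\<dots> \<le> period H h" by (simp add: period_def less_imp_le)
    also have "\<dots> = 2 ^ (K - (H - h) div 2) * 2 ^ h"
      using e by (simp add: period_def flip: power_add)
    finally have "code_count (Suc h) zs \<le> 2 ^ (K - (H - h) div 2)" by simp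
    then have "real (code_count (Suc h) zs) \<le> 2 ^ (K - (H - h) div 2)"
      by (metis of_nat_le_iff of_nat_numeral of_nat_power)
    also have "\<dots> = 2 ^ K * (1/2) ^ ((H - h) div 2)" using e by (simp add: power_diff power_divide)
    finally show ?thesis .
  qed
  have lev': "real (code_count (Suc h) zs) \<le> 2 ^ K * (1/2) ^ ((H - h) div 2)" if "h \<le> H" for h
    using that lev[of h] zero[of h] by (cases "base H \<le> h") auto
  have top: "real (code_count (H + 2) zs) \<le> 2 ^ K"
  proof -
    have "code_count (H + 2) zs * 2 ^ Suc H \<le> weight_below (H + 2) zs" using weight_below_Suc[of "Suc H" zs] by simp
    also have "\<dots> \<le> n" using bal unfolding progress_def by linarith
    also have "\<dots> \<le> 2 ^ K * 2 ^ H" using n by (simp add: power_add mult.commute)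
    also have "\<dots> \<le> 2 ^ K * 2 ^ Suc H" by simp
    finally have "code_count (H + 2) zs \<le> 2 ^ K" by simp
    then show ?thesis by (metis of_nat_le_iff of_nat_numeral of_nat_power)
  qed
  have c0: "code_count 0 zs \<le> 1" using bal unfolding progress_def by simp
  have "(\<Sum>h<Suc H. real (code_count (Suc h) zs)) \<le> (\<Sum>h<Suc H. 2 ^ K * (1/2) ^ ((H - h) div 2))"
    by (intro sum_mono lev') auto
  also have "\<dots> = 2 ^ K * (\<Sum>d<Suc H. (1/2) ^ (d div 2))"
    unfolding sum_distrib_left by (subst sum.nat_diff_reindex[symmetric]) simp
  also have "\<dots> \<le> 2 ^ K * 4" by (intro mult_left_mono sum_half_powers) auto
  finally have mid: "(\<Sum>h<Suc H. real (code_count (Suc h) zs)) \<le> 4 * 2 ^ K" by simp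
  have "real (length zs) = (\<Sum>c<Suc (Suc (Suc H)). real (code_count c zs))"
    using length_eq_sum_code_count[OF codes] by (simp add: numeral_3_eq_3)
  also have "\<dots> = real (code_count 0 zs) + (\<Sum>h<Suc H. real (code_count (Suc h) zs)) + real (code_count (H + 2) zs)"
    by (subst sum.lessThan_Suc_shift) simp
  also have "\<dots> \<le> 1 + 4 * 2 ^ K + 2 ^ K" using mid top c0 by linarith
  also have "\<dots> \<le> 6 * 2 ^ K" by simp
  finally show ?thesis .
qed

text \<open>The \<open>13\<close> covers up to \<open>6 * 2 ^ K\<close> items, as many codes, and
  the word for the stream length.\<close>

lemma sketch_space:
  assumes "13 * 2 ^ K \<le> S"
  shows "space_at_most TYPE('a::linorder) (sketch_alg noise) S"
  unfolding space_at_most_def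
proof (intro allI ballI, clarify)
  fix xs :: "'a list" and items ws
  assume "(items, ws) \<in> set_pmf (run_stream (sketch_alg noise) xs)"
  then obtain zs where zs: "zs \<in> set_pmf (states xs)" and eq: "(items, ws) = encode (length xs) zs"
    unfolding run_stream_sketch by auto
  have "real (length zs) \<le> 6 * 2 ^ K"
    using balanced_length[OF balanced_states[OF zs] epoch_ge] .
  moreover have "real (length items + length ws) = 2 * real (length zs) + 1" using eq by (simp add: encode_def)
  moreover have "(1::real) \<le> 2 ^ K" by simp
  ultimately show "real (length items + length ws) \<le> S" using assms by linarith
qed

lemma sketch_words: "words_fit TYPE('a::linorder) (sketch_alg noise) 2"
  unfolding words_fit_def
proof (intro allI ballI, clarify)
  fix xs :: "'a list" and items ws w
  assume "(items, ws) \<in> set_pmf (run_stream (sketch_alg noise) xs)" and w: "w \<in> set ws"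
  then obtain zs where zs: "zs \<in> set_pmf (states xs)" and eq: "(items, ws) = encode (length xs) zs"
    unfolding run_stream_sketch by auto
  have "fst z \<le> length xs + 2" if "z \<in> set zs" for z
    using balanced_states[OF zs] that epoch_le_self[of "length xs"] unfolding progress_def by force
  then have "w \<le> length xs + 2" using eq w by (auto simp: encode_def)
  also have "\<dots> < (length xs + 2) ^ 2" by (simp add: power2_eq_square)
  finally show "w < (length xs + 2) ^ 2" .
qed

end

subsection \<open>Moment generating function of the error\<close>

definition held :: "('b \<Rightarrow> bool) \<Rightarrow> (nat \<times> 'b) list \<Rightarrow> bool" where
  "held Q zs \<longleftrightarrow> (\<exists>z\<in>set zs. fst z = 0 \<and> Q (snd z))"

lemma est_simps [simp]:
  "est Q [] = 0"
  "est Q (z # zs) = (if fst z \<noteq> 0 \<and> Q (snd z) then 2 ^ (fst z - 1) else 0) + est Q zs"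
  "est Q (xs @ ys) = est Q xs + est Q ys"
  by (simp_all add: est_def)

lemma est_map_Pair: "est Q (map (Pair (Suc h)) us) = 2 ^ h * length (filter Q us)"
  by (induction us) auto

lemma est_split_level:
  "est Q zs = est Q (filter (\<lambda>z. fst z \<noteq> Suc h) zs) +
     2 ^ h * length (filter Q (map snd (filter (\<lambda>z. fst z = Suc h) zs)))"
  by (induction zs) auto

lemma est_release:
  "est Q (release h zs) = est Q zs + 2 ^ h * length (filter (\<lambda>z. fst z = 0 \<and> Q (snd z)) zs)"
  by (induction zs) (auto simp: release_def)

lemma est_offer: "est Q (offer b y zs) = est Q zs"
proof -
  have "est Q (filter (\<lambda>z. 0 < fst z) zs) = est Q zs" by (induction zs) auto
  then show ?thesis by (simp add: offer_def)
qed

lemma held_offer: "held Q (offer b y zs) = (if b then Q y else held Q zs)"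
  by (auto simp: held_def offer_def)

lemma held_release: "\<not> held Q (release h zs)"
  by (auto simp: held_def release_def)

lemma held_compact: "held Q (compact_level key h b zs) = held Q zs"
  by (auto simp: held_def compact_level_def)

lemma length_filter_held:
  assumes "code_count 0 zs \<le> 1"
  shows "length (filter (\<lambda>z. fst z = 0 \<and> Q (snd z)) zs) = of_bool (held Q zs)"
proof (cases "held Q zs")
  case True
  have "length (filter (\<lambda>z. fst z = 0 \<and> Q (snd z)) zs) = length (filter (\<lambda>z. Q (snd z)) (filter (\<lambda>z. fst z = 0) zs))"
    by (simp add: conj_commute)
  also have "\<dots> \<le> 1" using assms length_filter_le unfolding code_count_def by (rule order_trans[rotated])
  finally show ?thesis using True by (auto simp: held_def filter_empty_conv le_Suc_eq)
next
  case False
  then show ?thesis by (auto simp: held_def filter_empty_conv)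
qed

text \<open>The two outcomes are the old estimate plus and minus \<open>2 ^ h * d\<close> with
  \<open>d\<close> equal to \<open>0\<close> or \<open>1\<close>. So a compaction is unbiased, and
  Hoeffding's bound applies with range \<open>2 * 2 ^ h * d\<close>.\<close>

lemma compact_mgf:
  fixes x :: "'a::linorder" and l :: real
  defines "Q \<equiv> \<lambda>y. y \<le> x"
  shows "(exp (l * real (est Q (compact_level (\<lambda>x. x) h True zs))) + exp (l * real (est Q (compact_level (\<lambda>x. x) h False zs)))) / 2
    \<le> exp (l * real (est Q zs) + l\<^sup>2 / 2 * 4 ^ h)"
proof -
  define us where "us = map snd (filter (\<lambda>z. fst z = Suc h) zs)"
  define a where "a b = length (filter Q (alternate b (sort us)))" for b
  define E where "E = est Q (filter (\<lambda>z. fst z \<noteq> Suc h) zs)"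
  have "mset (filter Q (sort us)) = mset (filter Q us)" by simp
  then have "length (filter Q us) = length (filter Q (sort us))" by (metis size_mset)
  also have "\<dots> = a True + a False" unfolding a_def by (rule count_alternate_sum[symmetric])
  finally have e: "est Q zs = E + 2 ^ h * (a True + a False)"
    using est_split_level[of Q zs h] unfolding E_def us_def by simp
  have c: "est Q (compact_level (\<lambda>x. x) h b zs) = E + 2 * 2 ^ h * a b" for b
    by (simp add: compact_level_def est_map_Pair[of _ "Suc h"] E_def a_def us_def)
  define d where "d = real (a True) - real (a False)"
  have "a True = a False \<or> a True = Suc (a False)"
    unfolding a_def Q_def by (rule count_alternate_sorted) simp
  then have d: "d = 0 \<or> d = 1" unfolding d_def by auto
  have tf: "real (est Q (compact_level (\<lambda>x. x) h True zs)) = est Q zs + 2 ^ h * d"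
    "real (est Q (compact_level (\<lambda>x. x) h False zs)) = est Q zs - 2 ^ h * d"
    unfolding c e d_def by (simp_all add: algebra_simps)
  have le: "(2 * 2 ^ h * d)\<^sup>2 \<le> 4 * 4 ^ h"
  proof -
    have "(2::real) ^ h * 2 ^ h = 4 ^ h" by (simp flip: power_mult_distrib)
    then show ?thesis using d by (auto simp: power2_eq_square)
  qed
  have "exp (l * real (est Q (compact_level (\<lambda>x. x) h True zs))) = exp (l * real (est Q zs)) * exp (l * (2 ^ h * d))"
    by (simp only: tf distrib_left exp_add)
  moreover have "exp (l * real (est Q (compact_level (\<lambda>x. x) h False zs))) = exp (l * real (est Q zs)) * exp (- (l * (2 ^ h * d)))"
    by (simp only: tf right_diff_distrib exp_diff exp_minus divide_inverse)
  ultimately have "(exp (l * real (est Q (compact_level (\<lambda>x. x) h True zs))) + exp (l * real (est Q (compact_level (\<lambda>x. x) h False zs)))) / 2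
    = exp (l * real (est Q zs)) * ((1/2) * exp (l * ((2 * 2 ^ h * d) * (1 - 1/2))) + (1 - 1/2) * exp (l * (- (2 * 2 ^ h * d) * (1/2))))"
    by (simp add: algebra_simps)
  also have "\<dots> \<le> exp (l * real (est Q zs)) * exp (l\<^sup>2 * (2 * 2 ^ h * d)\<^sup>2 / 8)"
    by (intro mult_left_mono two_point_hoeffding) auto
  also have "\<dots> \<le> exp (l * real (est Q zs)) * exp (l\<^sup>2 * (4 * 4 ^ h) / 8)"
    by (intro mult_left_mono iffD2[OF exp_le_cancel_iff] divide_right_mono le) auto
  also have "\<dots> = exp (l * real (est Q zs) + l\<^sup>2 / 2 * 4 ^ h)" by (simp add: exp_add)
  finally show ?thesis by simp
qed

lemma nn_integral_bernoulli_real: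
  fixes g :: "bool \<Rightarrow> real"
  assumes "0 \<le> p" "p \<le> 1" "\<And>b. 0 \<le> g b"
  shows "(\<integral>\<^sup>+ b. ennreal (g b) \<partial>bernoulli_pmf p) = ennreal (p * g True + (1 - p) * g False)"
  using assms by (simp add: ennreal_mult' mult.commute)

context sketch
begin

text \<open>Every compaction uses a fresh fair coin, so the variance terms add up in the exponent.
  Compactions leave the reservoir alone, so the factor with \<open>f\<close> passes through.\<close>

lemma cascade_mgf:
  fixes x :: "'a::linorder" and l :: real and f :: "bool \<Rightarrow> real"
  defines "Q \<equiv> \<lambda>y. y \<le> x"
  assumes f: "\<And>b. 0 \<le> f b"
  shows "(\<integral>\<^sup>+ zs'. ennreal (exp (l * real (est Q zs')) * f (held Q zs')) \<partial>cascade (\<lambda>x. x) H N hs zs)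
    \<le> ennreal (exp (l * real (est Q zs) + l\<^sup>2 / 2 * (\<Sum>h\<leftarrow>hs. if period H h dvd N then 4 ^ h else 0)) * f (held Q zs))"
proof (induction hs arbitrary: zs)
  case Nil
  then show ?case by simp
next
  case (Cons h hs)
  define S where "S = (\<Sum>h\<leftarrow>hs. if period H h dvd N then 4 ^ h else 0 :: real)"
  define J where "J zs = (\<integral>\<^sup>+ zs'. ennreal (exp (l * real (est Q zs')) * f (held Q zs')) \<partial>cascade (\<lambda>x. x) H N hs zs)" for zs
  define g where "g b = exp (l * real (est Q (compact_level (\<lambda>x. x) h b zs)))" for b
  show ?case
  proof (cases "period H h dvd N")
    case True
    have J: "J (compact_level (\<lambda>x. x) h b zs) \<le> ennreal (g b * (exp (l\<^sup>2 / 2 * S) * f (held Q zs)))" for b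
      using Cons.IH[of "compact_level (\<lambda>x. x) h b zs"]
      by (simp add: J_def S_def g_def held_compact exp_add mult.assoc)
    have "(\<integral>\<^sup>+ zs'. ennreal (exp (l * real (est Q zs')) * f (held Q zs')) \<partial>cascade (\<lambda>x. x) H N (h # hs) zs)
      = (\<integral>\<^sup>+ b. J (compact_level (\<lambda>x. x) h b zs) \<partial>bernoulli_pmf (1/2))"
      using True by (simp add: J_def)
    also have "\<dots> \<le> (\<integral>\<^sup>+ b. ennreal (g b * (exp (l\<^sup>2 / 2 * S) * f (held Q zs))) \<partial>bernoulli_pmf (1/2))"
      by (intro nn_integral_mono J)
    also have "\<dots> = ennreal ((g True + g False) / 2 * (exp (l\<^sup>2 / 2 * S) * f (held Q zs)))"
      using f by (subst nn_integral_bernoulli_real) (auto simp: g_def algebra_simps add_divide_distrib)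
    also have "\<dots> \<le> ennreal (exp (l * real (est Q zs) + l\<^sup>2 / 2 * 4 ^ h) * (exp (l\<^sup>2 / 2 * S) * f (held Q zs)))"
      using compact_mgf[of l x h zs] f unfolding g_def Q_def by (intro ennreal_leI mult_right_mono) auto
    also have "\<dots> = ennreal (exp (l * real (est Q zs) + l\<^sup>2 / 2 * (4 ^ h + S)) * f (held Q zs))"
      by (simp add: exp_add algebra_simps add_divide_distrib)
    finally show ?thesis using True by (simp add: S_def)
  next
    case False
    then show ?thesis using Cons.IH[of zs] by simp
  qed
qed

definition level_variance :: "nat \<Rightarrow> nat \<Rightarrow> real" where
  "level_variance H N = (\<Sum>h = base H..H. if period H h dvd N then 4 ^ h else 0)"

text \<open>Blocks of size \<open>1\<close> are copied exactly, so nothing is charged when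
  \<open>base H = 0\<close>.\<close>

definition block_variance :: "nat \<Rightarrow> nat \<Rightarrow> real" where
  "block_variance H N = (if 0 < base H \<and> block H dvd N then 4 ^ base H else 0)"

primrec variance :: "nat \<Rightarrow> real" where
  "variance 0 = 0"
| "variance (Suc n) = variance n +
     (level_variance (epoch (Suc n)) (Suc n) + block_variance (epoch (Suc n)) (Suc n))"

text \<open>Pulls a test function back over the end of a block: a released item that satisfies the
  query adds \<open>block H\<close> to the estimate, and the reservoir is empty afterwards.\<close>

definition block_end :: "real \<Rightarrow> nat \<Rightarrow> nat \<Rightarrow> (bool \<Rightarrow> real) \<Rightarrow> bool \<Rightarrow> real" where
  "block_end l H N f b = (if block H dvd N then exp (l * (real (block H) * of_bool b)) * f False else f b)"

lemma settle_mgf: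
  fixes x :: "'a::linorder" and l :: real and f :: "bool \<Rightarrow> real"
  defines "Q \<equiv> \<lambda>y. y \<le> x"
  assumes f: "\<And>b. 0 \<le> f b" and c: "code_count 0 zs \<le> 1"
  shows "(\<integral>\<^sup>+ zs'. ennreal (exp (l * real (est Q zs')) * f (held Q zs')) \<partial>settle (\<lambda>x. x) H N zs)
    \<le> ennreal (exp (l * real (est Q zs) + l\<^sup>2 / 2 * level_variance H N) * block_end l H N f (held Q zs))"
proof -
  have lv: "(\<Sum>h\<leftarrow>[base H..<Suc H]. if period H h dvd N then 4 ^ h else 0) = level_variance H N"
    unfolding level_variance_def interv_sum_list_conv_sum_set_nat set_upt atLeastLessThanSuc_atLeastAtMost ..
  show ?thesis
  proof (cases "block H dvd N")
    case True
    have "est Q (release (base H) zs) = est Q zs + block H * of_bool (held Q zs)"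
      by (simp add: est_release length_filter_held[OF c] block_def)
    then show ?thesis
      using cascade_mgf[where f = f and x = x and l = l and H = H and N = N and hs = "[base H..<Suc H]" and zs = "release (base H) zs", OF f] True
      unfolding settle_def lv block_end_def Q_def
      by (simp add: held_release exp_add algebra_simps del: upt_Suc)
  next
    case False
    then show ?thesis
      using cascade_mgf[where f = f and x = x and l = l and H = H and N = N and hs = "[base H..<Suc H]" and zs = zs, OF f]
      unfolding settle_def lv block_end_def Q_def by (simp del: upt_Suc)
  qed
qed

lemma step_mgf:
  fixes x y :: "'a::linorder" and l :: real and f :: "bool \<Rightarrow> real"
  defines "Q \<equiv> \<lambda>y. y \<le> x"
  assumes f: "\<And>b. 0 \<le> f b" and c: "code_count 0 zs \<le> 1"
  shows "(\<integral>\<^sup>+ zs'. ennreal (exp (l * real (est Q zs')) * f (held Q zs')) \<partial>step (\<lambda>x. x) H n y zs)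
    \<le> ennreal (exp (l * real (est Q zs) + l\<^sup>2 / 2 * level_variance H (Suc n)) *
         ((block_end l H (Suc n) f (Q y) + real (n mod block H) * block_end l H (Suc n) f (held Q zs)) / real (Suc (n mod block H))))"
proof -
  define i where "i = real (n mod block H)"
  have i: "0 \<le> i" by (simp add: i_def)
  define p where "p = 1 / (1 + i)"
  have p: "0 \<le> p" "p \<le> 1" "1 - p = i / (1 + i)" using i by (auto simp: p_def field_simps)
  define E where "E = exp (l * real (est Q zs) + l\<^sup>2 / 2 * level_variance H (Suc n))"
  define F where "F = block_end l H (Suc n) f"
  have F: "0 \<le> F b" for b using f by (simp add: F_def block_end_def)
  have "(\<integral>\<^sup>+ zs'. ennreal (exp (l * real (est Q zs')) * f (held Q zs')) \<partial>step (\<lambda>x. x) H n y zs)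
     = (\<integral>\<^sup>+ b. (\<integral>\<^sup>+ zs'. ennreal (exp (l * real (est Q zs')) * f (held Q zs')) \<partial>settle (\<lambda>x. x) H (Suc n) (offer b y zs)) \<partial>bernoulli_pmf p)"
    by (simp add: step_def p_def i_def)
  also have "\<dots> \<le> (\<integral>\<^sup>+ b. ennreal (E * F (if b then Q y else held Q zs)) \<partial>bernoulli_pmf p)"
  proof (rule nn_integral_mono)
    fix b
    have "code_count 0 (offer b y zs) \<le> 1" using c by (simp add: code_count_offer)
    from settle_mgf[where f = f, OF f this, where x = x and l = l and H = H and N = "Suc n"]
    show "(\<integral>\<^sup>+ zs'. ennreal (exp (l * real (est Q zs')) * f (held Q zs')) \<partial>settle (\<lambda>x. x) H (Suc n) (offer b y zs))
       \<le> ennreal (E * F (if b then Q y else held Q zs))"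
      unfolding Q_def E_def F_def est_offer held_offer by simp
  qed
  also have "\<dots> = ennreal (p * (E * F (Q y)) + (1 - p) * (E * F (held Q zs)))"
    using p F by (subst nn_integral_bernoulli_real) (auto simp: E_def)
  also have "p * (E * F (Q y)) + (1 - p) * (E * F (held Q zs)) = E * ((F (Q y) + i * F (held Q zs)) / (1 + i))"
    unfolding p(3) by (simp add: p_def add_divide_distrib algebra_simps)
  finally show ?thesis by (simp add: E_def F_def i_def)
qed

section \<open>Finished blocks and the pending block\<close>

definition whole_blocks :: "nat \<Rightarrow> 'a list \<Rightarrow> 'a list" where
  "whole_blocks H xs = take (length xs - length xs mod block H) xs"

definition partial_block :: "nat \<Rightarrow> 'a list \<Rightarrow> 'a list" where
  "partial_block H xs = drop (length xs - length xs mod block H) xs"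

lemma length_partial_block: "length (partial_block H xs) = length xs mod block H"
  by (simp add: partial_block_def)

lemma blocks_append: "whole_blocks H xs @ partial_block H xs = xs"
  by (simp add: whole_blocks_def partial_block_def)

lemma blocks_snoc_inner:
  assumes "\<not> block H dvd Suc (length xs)"
  shows "whole_blocks H (xs @ [x]) = whole_blocks H xs" "partial_block H (xs @ [x]) = partial_block H xs @ [x]"
  using assms by (auto simp: whole_blocks_def partial_block_def Suc_mod)

lemma blocks_snoc_end:
  assumes "block H dvd Suc (length xs)"
  shows "whole_blocks H (xs @ [x]) = xs @ [x]" "partial_block H (xs @ [x]) = []"
  using assms by (auto simp: whole_blocks_def partial_block_def)

lemma blocks_aligned:
  assumes "block H dvd length xs"
  shows "whole_blocks H xs = xs" "partial_block H xs = []"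
  using assms by (auto simp: whole_blocks_def partial_block_def)

text \<open>If \<open>r\<close> of the \<open>s\<close> items of a block are counted, a uniform
  sample of weight \<open>s\<close> contributes \<open>s\<close> with probability
  \<open>r / s\<close>, hence \<open>r\<close> on average. So sampling is unbiased and costs one
  Hoeffding term of range \<open>s\<close>.\<close>

lemma block_average_end:
  assumes "length ys = block H" "block H dvd N" "0 \<le> f False"
  shows "block_average Q ys (block_end l H N f)
    \<le> exp (l * real (length (filter Q ys)) + l\<^sup>2 / 2 * block_variance H N) * f False"
proof -
  define s r where "s = real (block H)" and "r = real (length (filter Q ys))"
  have s: "s \<ge> 1" by (simp add: s_def block_def)
  have r: "0 \<le> r" "r \<le> s" using assms(1) length_filter_le[of Q ys] by (auto simp: r_def s_def)
  have "ys \<noteq> []" using assms(1) by (auto simp: block_def)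
  then have "block_average Q ys (block_end l H N f) = (r * (exp (l * s) * f False) + (s - r) * f False) / s"
    using assms by (simp add: block_average_def block_end_def r_def[symmetric] s_def[symmetric])
  also have "\<dots> = (r / s * exp (l * s) + (1 - r / s)) * f False"
    using s by (simp add: field_simps)
  also have "\<dots> \<le> exp (l * r + l\<^sup>2 / 2 * block_variance H N) * f False"
  proof (intro mult_right_mono assms(3))
    show "r / s * exp (l * s) + (1 - r / s) \<le> exp (l * r + l\<^sup>2 / 2 * block_variance H N)"
    proof (cases "base H = 0")
      case True
      then have "s = 1" by (simp add: s_def block_def)
      moreover have "r = 0 \<or> r = 1"
        using r \<open>s = 1\<close> unfolding r_def by (metis le_zero_eq le_Suc_eq of_nat_0 of_nat_1 of_nat_le_1_iff One_nat_def)
      ultimately show ?thesis using True by (auto simp: block_variance_def)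
    next
      case False
      define p where "p = r / s"
      have p: "0 \<le> p" "p \<le> 1" "s * p = r" using r s by (auto simp: p_def field_simps)
      have "p * exp (l * s) + (1 - p) = exp (l * r) * (p * exp (l * (s * (1 - p))) + (1 - p) * exp (l * (- s * p)))"
        using p(3) by (simp add: algebra_simps exp_diff exp_minus)
      also have "\<dots> \<le> exp (l * r) * exp (l\<^sup>2 * s\<^sup>2 / 8)"
        by (intro mult_left_mono two_point_hoeffding p) auto
      \<comment> \<open>Weakening \<open>1/8\<close> to \<open>1/2\<close> gives sampling the same
        normalisation as the compaction terms.\<close>
      also have "\<dots> \<le> exp (l * r) * exp (l\<^sup>2 * s\<^sup>2 / 2)"
        by (intro mult_left_mono) (auto intro: divide_left_mono)
      also have "s\<^sup>2 = block_variance H N"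
        using False assms(2) by (simp add: s_def block_def block_variance_def power2_eq_square flip: power_mult_distrib)
      finally show ?thesis by (simp add: p_def exp_add)
    qed
  qed
  finally show ?thesis by (simp add: r_def)
qed


text \<open>
  Only \<open>f = (\<lambda>_. 1)\<close> is needed in the end. Arbitrary \<open>f\<close> express that the reservoir item is uniform on
  the pending block and independent of the error so far, which makes the induction go through and
  charges a whole block, not every step of the reservoir, with one variance term.
\<close>

lemma states_mgf:
  fixes x :: "'a::linorder" and l :: real and f :: "bool \<Rightarrow> real"
  defines "Q \<equiv> \<lambda>y. y \<le> x"
  assumes "\<And>b. 0 \<le> f b"
  shows "(\<integral>\<^sup>+ zs. ennreal (exp (l * real (est Q zs)) * f (held Q zs)) \<partial>states xs)
    \<le> ennreal (exp (l * real (length (filter Q (whole_blocks (epoch (length xs)) xs))) + l\<^sup>2 / 2 * variance (length xs))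
         * block_average Q (partial_block (epoch (length xs)) xs) f)"
  using assms(2)
proof (induction xs arbitrary: f rule: rev_induct)
  case Nil
  then show ?case
    by (simp add: held_def whole_blocks_def partial_block_def block_average_def)
next
  case (snoc y xs)
  let ?n = "length xs"
  define H where "H = epoch (Suc ?n)"
  define W where "W = real (length (filter Q (whole_blocks H xs)))"
  define ps where "ps = partial_block H xs"
  define F where "F = block_end l H (Suc ?n) f"
  \<comment> \<open>The coming reservoir step folded into the test function; the induction
    hypothesis is applied to it in place of \<open>f\<close>.\<close>
  define f' where "f' b = (F (Q y) + real (length ps) * F b) / real (Suc (length ps))" for b
  have F: "0 \<le> F b" for b using snoc.prems by (simp add: F_def block_end_def)
  have f': "0 \<le> f' b" for b using F by (simp add: f'_def)
  have f'_eq: "f' b = (F (y \<le> x) + real (length ps) * F b) / (1 + real (length ps))" for b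
    by (simp add: f'_def Q_def)
  have lps: "length ps = ?n mod block H" by (simp add: ps_def length_partial_block)
  have IH: "(\<integral>\<^sup>+ zs. ennreal (exp (l * real (est Q zs)) * f' (held Q zs)) \<partial>states xs)
    \<le> ennreal (exp (l * W + l\<^sup>2 / 2 * variance ?n) * block_average Q ps f')"
  proof (cases rule: epoch_Suc_cases[of ?n])
    case 1
    then show ?thesis using snoc.IH[of f'] f' by (simp add: W_def ps_def H_def)
  next
    case 2
    \<comment> \<open>At a change of epoch both block sizes divide the length, so nothing is pending
      and the two decompositions agree.\<close>
    have "block (epoch ?n) dvd ?n" "block H dvd ?n"
      using block_dvd_top[of "epoch ?n"] block_Suc_dvd_top[of "epoch ?n"] 2 by (simp_all add: H_def)
    then show ?thesis using snoc.IH[of f'] f' by (simp add: W_def ps_def blocks_aligned)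
  qed
  have "(\<integral>\<^sup>+ zs. ennreal (exp (l * real (est Q zs)) * f (held Q zs)) \<partial>states (xs @ [y]))
     = (\<integral>\<^sup>+ us. (\<integral>\<^sup>+ zs. ennreal (exp (l * real (est Q zs)) * f (held Q zs)) \<partial>step (\<lambda>x. x) H ?n y us) \<partial>states xs)"
    by (simp add: states_snoc H_def)
  also have "\<dots> \<le> (\<integral>\<^sup>+ us. ennreal (exp (l\<^sup>2 / 2 * level_variance H (Suc ?n))) *
      ennreal (exp (l * real (est Q us)) * f' (held Q us)) \<partial>states xs)"
  proof (rule nn_integral_mono_AE, unfold AE_measure_pmf_iff, rule ballI)
    fix us assume "us \<in> set_pmf (states xs)"
    then have c: "code_count 0 us \<le> 1" using balanced_states unfolding progress_def by fastforce
    show "(\<integral>\<^sup>+ zs. ennreal (exp (l * real (est Q zs)) * f (held Q zs)) \<partial>step (\<lambda>x. x) H ?n y us)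
      \<le> ennreal (exp (l\<^sup>2 / 2 * level_variance H (Suc ?n))) * ennreal (exp (l * real (est Q us)) * f' (held Q us))"
      using step_mgf[where f = f and x = x and l = l and H = H and n = ?n and y = y, OF snoc.prems c]
      unfolding Q_def[symmetric] lps[symmetric] F_def[symmetric]
      by (simp add: exp_add mult_ac f'_eq ennreal_mult'[symmetric])
  qed
  also have "\<dots> = ennreal (exp (l\<^sup>2 / 2 * level_variance H (Suc ?n))) *
      (\<integral>\<^sup>+ us. ennreal (exp (l * real (est Q us)) * f' (held Q us)) \<partial>states xs)"
    by (rule nn_integral_cmult) simp
  also have "\<dots> \<le> ennreal (exp (l\<^sup>2 / 2 * level_variance H (Suc ?n))) *
      ennreal (exp (l * W + l\<^sup>2 / 2 * variance ?n) * block_average Q ps f')"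
    by (intro mult_left_mono IH) simp
  also have "block_average Q ps f' = block_average Q (ps @ [y]) F"
    unfolding f'_def by (rule block_average_snoc)
  also have "ennreal (exp (l\<^sup>2 / 2 * level_variance H (Suc ?n))) *
      ennreal (exp (l * W + l\<^sup>2 / 2 * variance ?n) * block_average Q (ps @ [y]) F)
    = ennreal (exp (l * W + l\<^sup>2 / 2 * (variance ?n + level_variance H (Suc ?n))) * block_average Q (ps @ [y]) F)"
    by (simp add: ennreal_mult'[symmetric] exp_add algebra_simps add_divide_distrib)
  also have "\<dots> \<le> ennreal (exp (l * real (length (filter Q (whole_blocks H (xs @ [y])))) + l\<^sup>2 / 2 * variance (Suc ?n))
         * block_average Q (partial_block H (xs @ [y])) f)"
  proof (cases "block H dvd Suc ?n")
    case False
    then have "F = f" "block_variance H (Suc ?n) = 0"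
      by (auto simp: F_def block_end_def block_variance_def)
    then show ?thesis using blocks_snoc_inner[OF False, of y] by (simp add: W_def ps_def H_def[symmetric])
  next
    case True
    have "length (ps @ [y]) = block H" using Suc_mod_dvd[OF True] by (simp add: lps)
    from block_average_end[of "ps @ [y]" H "Suc ?n" f Q l, OF this True snoc.prems]
    have "exp (l * W + l\<^sup>2 / 2 * (variance ?n + level_variance H (Suc ?n))) * block_average Q (ps @ [y]) F
      \<le> exp (l * W + l\<^sup>2 / 2 * (variance ?n + level_variance H (Suc ?n))) *
        (exp (l * real (length (filter Q (ps @ [y]))) + l\<^sup>2 / 2 * block_variance H (Suc ?n)) * f False)"
      unfolding F_def by (intro mult_left_mono) auto
    also have "\<dots> = exp (l * (W + real (length (filter Q (ps @ [y])))) + l\<^sup>2 / 2 * variance (Suc ?n)) * f False"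
      by (simp add: H_def[symmetric] exp_add algebra_simps add_divide_distrib)
    also have "W + real (length (filter Q (ps @ [y]))) = real (length (filter Q (xs @ [y])))"
    proof -
      have "filter Q xs = filter Q (whole_blocks H xs) @ filter Q ps"
        unfolding ps_def by (metis blocks_append filter_append)
      then show ?thesis by (simp add: W_def)
    qed
    finally show ?thesis using blocks_snoc_end[OF True, of y]
      by (simp add: block_average_def ennreal_leI)
  qed
  finally show ?case by (simp add: H_def)
qed

section \<open>Total variance\<close>

text \<open>
  The variance that would accumulate if all \<open>n\<close> items were processed with the schedule of epoch \<open>H\<close>.
\<close>

definition epoch_variance :: "nat \<Rightarrow> nat \<Rightarrow> real" where
  "epoch_variance H n = (\<Sum>h = base H..H. 4 ^ h * real (n div period H h)) +
     (if 0 < base H then 4 ^ base H * real (n div block H) else 0)"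

lemma epoch_variance_Suc:
  "epoch_variance H (Suc n) = epoch_variance H n + (level_variance H (Suc n) + block_variance H (Suc n))"
proof -
  have *: "real (Suc n div P) = real (n div P) + (if P dvd Suc n then 1 else 0)" for P
    by (simp add: div_Suc dvd_eq_mod_eq_0)
  show ?thesis
    unfolding epoch_variance_def level_variance_def block_variance_def *
    by (auto simp: distrib_left sum.distrib intro!: sum.cong)
qed

text \<open>Level \<open>h\<close> contributes at most \<open>n * 2 ^ H / 2 ^ K\<close> times a
  power of \<open>1/2\<close> whose exponent is \<open>(H - h) / 2\<close> rounded up. These powers
  sum to at most \<open>3\<close>, and sampling adds at most \<open>1\<close>.\<close>

lemma epoch_variance_le: "epoch_variance H n \<le> 4 * real n * 2 ^ H / 2 ^ K"
proof -
  have dv: "real (n div P) \<le> real n / real P" for P by (rule of_nat_div_le_of_nat)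
  have "(\<Sum>h = base H..H. 4 ^ h * real (n div period H h))
     \<le> (\<Sum>h = base H..H. real n * 2 ^ H / 2 ^ K * (1/2) ^ ((H - h) - (H - h) div 2))"
  proof (rule sum_mono)
    fix h assume "h \<in> {base H..H}"
    then have h: "base H \<le> h" "h \<le> H" by auto
    then have e: "(H - h) div 2 \<le> K" by (auto simp: base_def)
    then have "h + K - (H - h) div 2 = h + (K - (H - h) div 2)" by simp
    then have "real (period H h) = 2 ^ h * 2 ^ (K - (H - h) div 2)"
      by (simp only: period_def power_add of_nat_mult of_nat_power of_nat_numeral)
    then have pr: "real (period H h) = 2 ^ h * (2 ^ K / 2 ^ ((H - h) div 2))"
      using e by (simp add: power_diff)
    have "4 ^ h * real (n div period H h) \<le> 4 ^ h * (real n / real (period H h))"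
      by (intro mult_left_mono dv) auto
    also have "\<dots> = real n * (4 ^ h / (2 ^ h * (2 ^ K / 2 ^ ((H - h) div 2))))"
      by (simp add: pr)
    also have "4 ^ h / (2 ^ h * (2 ^ K / 2 ^ ((H - h) div 2))) = (2::real) ^ h * 2 ^ ((H - h) div 2) / 2 ^ K"
    proof -
      have "(4::real) ^ h = 2 ^ h * 2 ^ h" by (simp flip: power_mult_distrib)
      then show ?thesis by simp
    qed
    also have "(2::real) ^ h * 2 ^ ((H - h) div 2) = 2 ^ H * (1/2) ^ ((H - h) - (H - h) div 2)"
    proof -
      have "(2::real) ^ H = 2 ^ (h + ((H - h) div 2) + ((H - h) - (H - h) div 2))"
        using h by (intro arg_cong[of _ _ "power 2"]) simp
      then show ?thesis by (simp add: power_add power_divide)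
    qed
    finally show "4 ^ h * real (n div period H h) \<le> real n * 2 ^ H / 2 ^ K * (1/2) ^ ((H - h) - (H - h) div 2)"
      by simp
  qed
  also have "\<dots> \<le> (\<Sum>h<Suc H. real n * 2 ^ H / 2 ^ K * (1/2) ^ ((H - h) - (H - h) div 2))"
    by (intro sum_mono2) auto
  also have "\<dots> = real n * 2 ^ H / 2 ^ K * (\<Sum>d<Suc H. (1/2) ^ (d - d div 2))"
    unfolding sum_distrib_left by (subst sum.nat_diff_reindex[symmetric]) simp
  also have "\<dots> \<le> real n * 2 ^ H / 2 ^ K * 3"
    by (intro mult_left_mono sum_half_powers_ceiling) auto
  finally have levels: "(\<Sum>h = base H..H. 4 ^ h * real (n div period H h)) \<le> real n * 2 ^ H / 2 ^ K * 3" .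
  have "(if 0 < base H then 4 ^ base H * real (n div block H) else 0) \<le> real n * 2 ^ H / 2 ^ K"
  proof (cases "0 < base H")
    case True
    have "4 ^ base H * real (n div block H) \<le> 4 ^ base H * (real n / 2 ^ base H)"
      using dv[of "block H"] by (intro mult_left_mono) (auto simp: block_def)
    also have "\<dots> = real n * 2 ^ base H"
    proof -
      have "(4::real) ^ base H = 2 ^ base H * 2 ^ base H" by (simp flip: power_mult_distrib)
      then show ?thesis by simp
    qed
    also have "\<dots> \<le> real n * (2 ^ H / 2 ^ K)"
    proof (intro mult_left_mono)
      \<comment> \<open>Since \<open>K \<ge> 2\<close> gives \<open>2 * K - 2 \<ge> K\<close>,
        sampling starts low enough to stay within the bound for a single level.\<close>
      have "base H \<le> H - K" "K \<le> H" using True K2 by (auto simp: base_def)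
      then show "(2::real) ^ base H \<le> 2 ^ H / 2 ^ K"
        by (simp flip: power_diff)
    qed simp
    finally show ?thesis using True by simp
  qed simp
  from add_mono[OF levels this]
  have "epoch_variance H n \<le> real n * 2 ^ H / 2 ^ K * 3 + real n * 2 ^ H / 2 ^ K"
    unfolding epoch_variance_def .
  then show ?thesis by simp
qed

text \<open>A finished epoch \<open>H\<close> costs at most \<open>4 * 4 ^ H\<close>, even when
  charged for all items since the start of the stream. The last term is the geometric sum over the
  finished epochs.\<close>

lemma variance_le_epoch: "variance n \<le> epoch_variance (epoch n) n + 4 / 3 * (4 ^ epoch n - 1)"
proof (induction n)
  case 0
  then show ?case by (simp add: epoch_variance_def)
next
  case (Suc n)
  have pos: "0 \<le> epoch_variance H m" for H m by (auto simp: epoch_variance_def intro!: sum_nonneg add_nonneg_nonneg)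
  show ?case
  proof (cases rule: epoch_Suc_cases[of n])
    case 1
    then show ?thesis using Suc by (simp add: epoch_variance_Suc)
  next
    case 2
    have n: "real n = 2 ^ epoch n * 2 ^ K" using 2(1) by (metis of_nat_numeral of_nat_power power_add)
    have "variance n \<le> 4 * real n * 2 ^ epoch n / 2 ^ K + 4 / 3 * (4 ^ epoch n - 1)"
      using Suc epoch_variance_le[of "epoch n" n] by linarith
    also have "4 * real n * 2 ^ epoch n / 2 ^ K = 4 * 4 ^ epoch n"
      unfolding n by (simp flip: power_mult_distrib)
    finally have "variance n \<le> 4 / 3 * (4 ^ Suc (epoch n) - 1)" by (simp add: field_simps)
    then show ?thesis
      using pos[of "Suc (epoch n)" n] unfolding variance.simps 2(2) epoch_variance_Suc by linarith
  qed
qed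

text \<open>From epoch \<open>1\<close> on, \<open>2 ^ epoch n\<close> is at most
  \<open>2 * a\<close> for \<open>a = n / 2 ^ K\<close>. The current epoch then costs at most
  \<open>8\<close> and the earlier ones at most \<open>6\<close> times the square of
  \<open>a\<close>, together \<open>14\<close>.\<close>

lemma variance_bound: "variance n \<le> 14 * (real n)\<^sup>2 / 4 ^ K"
proof (cases "epoch n = 0")
  case True
  then have n: "n \<le> 2 ^ K" using epoch_ge[of n] by simp
  \<comment> \<open>In epoch \<open>0\<close> only level \<open>0\<close> is in use, and it is first
    compacted at \<open>n = 2 ^ K\<close>, the last length of this epoch.\<close>
  have "variance n \<le> real (n div 2 ^ K)"
    using variance_le_epoch[of n] True by (simp add: epoch_variance_def base_def period_def)
  also have "\<dots> \<le> (real n)\<^sup>2 / 4 ^ K"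
  proof (cases "n = 2 ^ K")
    case True
    have "(real n)\<^sup>2 = 4 ^ K" unfolding True by (simp add: power2_eq_square flip: power_mult_distrib)
    then show ?thesis using True by simp
  next
    case False
    then show ?thesis using n by simp
  qed
  also have "\<dots> \<le> 14 * (real n)\<^sup>2 / 4 ^ K" by (intro divide_right_mono) auto
  finally show ?thesis .
next
  case False
  define a where "a = real n / 2 ^ K"
  obtain H where H: "epoch n = Suc H" using False not0_implies_Suc by blast
  have "2 ^ (H + K) < n" using epoch_gt[of H n] H by simp
  then have "(2::real) ^ H * 2 ^ K < real n" by (metis of_nat_less_iff of_nat_numeral of_nat_power power_add)
  then have e: "(2::real) ^ epoch n \<le> 2 * a" by (simp add: H a_def field_simps)
  have "(4::real) ^ epoch n = (2 ^ epoch n)\<^sup>2" by (simp add: power2_eq_square flip: power_mult_distrib)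
  also have "\<dots> \<le> (2 * a)\<^sup>2" using e by (intro power_mono) auto
  finally have e4: "(4::real) ^ epoch n \<le> 4 * a\<^sup>2" by (simp add: power_mult_distrib)
  have "epoch_variance (epoch n) n \<le> 4 * a * 2 ^ epoch n"
    using epoch_variance_le[of "epoch n" n] by (simp add: a_def)
  also have "\<dots> \<le> 4 * a * (2 * a)" using e by (intro mult_left_mono) (auto simp: a_def)
  finally have "epoch_variance (epoch n) n \<le> 8 * a\<^sup>2" by (simp add: power2_eq_square)
  moreover have "4 / 3 * (4 ^ epoch n - 1) \<le> 6 * a\<^sup>2"
  proof -
    have "4 / 3 * (u - 1) \<le> 6 * v" if "u \<le> 4 * v" "0 \<le> v" for u v :: real
      using that by (simp add: field_simps)
    from this[OF e4 zero_le_power2] show ?thesis .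
  qed
  ultimately have "variance n \<le> 14 * a\<^sup>2" using variance_le_epoch[of n] by linarith
  also have "a\<^sup>2 = (real n)\<^sup>2 / 4 ^ K"
    by (simp add: a_def power_divide power2_eq_square flip: power_mult_distrib)
  finally show ?thesis by simp
qed


section \<open>Tail bounds\<close>

text \<open>Markov's inequality for the exponential moment. The sign of \<open>l\<close> is free,
  which covers both tails; deviations are measured from the count over finished blocks.\<close>

lemma states_chernoff:
  fixes x :: "'a::linorder" and l :: real
  defines "Q \<equiv> \<lambda>y. y \<le> x"
  defines "W \<equiv> \<lambda>xs. real (length (filter Q (whole_blocks (epoch (length xs)) xs)))"
  shows "measure_pmf.prob (states xs) {zs. t \<le> l * (real (est Q zs) - W xs)}
    \<le> exp (l\<^sup>2 / 2 * variance (length xs) - t)"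
proof -
  have mgf: "(\<integral>\<^sup>+ zs. ennreal (exp (l * real (est Q zs))) \<partial>states xs)
    \<le> ennreal (exp (l * W xs + l\<^sup>2 / 2 * variance (length xs)))"
    using states_mgf[where f = "\<lambda>_. 1" and x = x and l = l and xs = xs]
    by (simp add: block_average_def W_def Q_def split: if_splits)
  have "ennreal (measure_pmf.prob (states xs) {zs. t \<le> l * (real (est Q zs) - W xs)})
      = (\<integral>\<^sup>+ zs. indicator {zs. t \<le> l * (real (est Q zs) - W xs)} zs \<partial>states xs)"
    by (simp add: measure_pmf.emeasure_eq_measure)
  also have "\<dots> \<le> (\<integral>\<^sup>+ zs. ennreal (exp (- l * W xs - t)) * ennreal (exp (l * real (est Q zs))) \<partial>states xs)"
  proof (rule nn_integral_mono)
    fix zs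
    show "indicator {zs. t \<le> l * (real (est Q zs) - W xs)} zs
      \<le> ennreal (exp (- l * W xs - t)) * ennreal (exp (l * real (est Q zs)))"
    proof (cases "t \<le> l * (real (est Q zs) - W xs)")
      case True
      then have "0 \<le> (- l * W xs - t) + l * real (est Q zs)" by (simp add: algebra_simps)
      then have "1 \<le> exp ((- l * W xs - t) + l * real (est Q zs))" by simp
      then show ?thesis using True by (simp only: exp_add ennreal_mult'[symmetric] exp_ge_zero) (simp add: ennreal_ge_1)
    qed simp
  qed
  also have "\<dots> = ennreal (exp (- l * W xs - t)) * (\<integral>\<^sup>+ zs. ennreal (exp (l * real (est Q zs))) \<partial>states xs)"
    by (rule nn_integral_cmult) simp
  also have "\<dots> \<le> ennreal (exp (- l * W xs - t)) * ennreal (exp (l * W xs + l\<^sup>2 / 2 * variance (length xs)))"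
    by (intro mult_left_mono mgf) simp
  also have "\<dots> = ennreal (exp (l\<^sup>2 / 2 * variance (length xs) - t))"
    by (simp add: ennreal_mult'[symmetric] exp_add[symmetric])
  finally show ?thesis by simp
qed

text \<open>Blocks larger than \<open>1\<close> occur only from epoch \<open>1\<close> on, where
  \<open>n\<close> exceeds half of \<open>2 ^ (epoch n + K)\<close>.\<close>

lemma partial_block_small: "real (n mod block (epoch n)) \<le> 2 * real n / 2 ^ K"
proof (cases "base (epoch n) = 0")
  case True
  then show ?thesis by (simp add: block_def)
next
  case False
  then obtain H where H: "epoch n = Suc H" by (metis base_def diff_0_eq_0 not0_implies_Suc)
  have "2 ^ (H + K) < n" using epoch_gt[of H n] H by simp
  then have "(2::real) ^ H * 2 ^ K < real n" by (metis of_nat_less_iff of_nat_numeral of_nat_power power_add)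
  then have "(2::real) ^ epoch n \<le> 2 * real n / 2 ^ K" by (simp add: H field_simps)
  moreover have "n mod block (epoch n) \<le> 2 ^ epoch n"
  proof -
    have "n mod block (epoch n) \<le> block (epoch n)" by (simp add: block_def less_imp_le)
    also have "\<dots> \<le> 2 ^ epoch n" unfolding block_def by (intro power_increasing base_le) simp
    finally show ?thesis .
  qed
  then have "real (n mod block (epoch n)) \<le> 2 ^ epoch n" by (metis of_nat_le_iff of_nat_numeral of_nat_power)
  ultimately show ?thesis by linarith
qed

text \<open>Half of the error budget pays for the pending block, which the estimate ignores, and is
  secured by \<open>K1\<close>; the other half pays for the random fluctuation, through
  \<open>K2\<close>.\<close>

lemma states_concentration:
  fixes x :: "'a::linorder" and e d :: real
  assumes e: "0 < e" and d: "0 < d" and K1: "4 / e \<le> 2 ^ K" and K2: "112 * ln (2 / d) \<le> e\<^sup>2 * 4 ^ K"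
  shows "1 - d \<le> measure_pmf.prob (states xs)
    {zs. \<bar>real (est (\<lambda>y. y \<le> x) zs) - real (length (filter (\<lambda>y. y \<le> x) xs))\<bar> \<le> e * real (length xs)}"
proof (cases "xs = []")
  case True
  then show ?thesis using d by (simp add: measure_return)
next
  case False
  let ?Q = "\<lambda>y. y \<le> x"
  define n where "n = real (length xs)"
  have n: "0 < n" using False by (simp add: n_def)
  define R where "R = real (length (filter ?Q xs))"
  define W where "W = real (length (filter ?Q (whole_blocks (epoch (length xs)) xs)))"
  define B where "B = 14 * n\<^sup>2 / 4 ^ K"
  have B: "0 < B" using n by (simp add: B_def)
  have V: "variance (length xs) \<le> B" using variance_bound[of "length xs"] by (simp add: B_def n_def)
  define a where "a = e * n / 2"
  have a: "0 < a" using e n by (simp add: a_def)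
  have RW: "W \<le> R" "R \<le> W + a"
  proof -
    let ?p = "partial_block (epoch (length xs)) xs"
    have "filter ?Q xs = filter ?Q (whole_blocks (epoch (length xs)) xs) @ filter ?Q ?p"
      by (metis blocks_append filter_append)
    then have R: "R = W + real (length (filter ?Q ?p))" by (simp add: R_def W_def)
    have "real (length (filter ?Q ?p)) \<le> real (length xs mod block (epoch (length xs)))"
      using length_filter_le[of ?Q ?p] by (simp add: length_partial_block)
    also have "\<dots> \<le> 2 * n / 2 ^ K" using partial_block_small[of "length xs"] by (simp add: n_def)
    also have "\<dots> \<le> a" using K1 e n by (simp add: a_def field_simps)
    finally show "W \<le> R" "R \<le> W + a" using R by auto
  qed
  \<comment> \<open>\<open>a / B\<close> is the optimal Chernoff parameter, and its negative serves
    the lower tail. The resulting exponent explains \<open>112 = 8 * 14\<close>.\<close>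
  have tail: "measure_pmf.prob (states xs) {zs. a\<^sup>2 / B \<le> l * (real (est ?Q zs) - W)} \<le> d / 2"
    if l: "l\<^sup>2 = (a / B)\<^sup>2" for l
  proof -
    have "measure_pmf.prob (states xs) {zs. a\<^sup>2 / B \<le> l * (real (est ?Q zs) - W)}
      \<le> exp (l\<^sup>2 / 2 * variance (length xs) - a\<^sup>2 / B)"
      unfolding W_def by (rule states_chernoff)
    also have "\<dots> \<le> exp (l\<^sup>2 / 2 * B - a\<^sup>2 / B)"
      using V by (auto intro!: mult_left_mono)
    also have "l\<^sup>2 / 2 * B - a\<^sup>2 / B = - (a\<^sup>2 / (2 * B))"
      unfolding l using B by (simp add: power2_eq_square field_simps)
    also have "a\<^sup>2 / (2 * B) = e\<^sup>2 * 4 ^ K / 112"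
      using n by (simp add: a_def B_def power2_eq_square field_simps)
    also have "exp (- (e\<^sup>2 * 4 ^ K / 112)) \<le> exp (- ln (2 / d))" using K2 by simp
    also have "\<dots> = d / 2" using d by (simp add: exp_minus)
    finally show ?thesis .
  qed
  have "measure_pmf.prob (states xs) {zs. \<not> \<bar>real (est ?Q zs) - R\<bar> \<le> e * n}
    \<le> measure_pmf.prob (states xs) ({zs. a\<^sup>2 / B \<le> (a / B) * (real (est ?Q zs) - W)} \<union>
        {zs. a\<^sup>2 / B \<le> (- a / B) * (real (est ?Q zs) - W)})"
  proof (intro measure_pmf.finite_measure_mono subsetI)
    fix zs assume "zs \<in> {zs. \<not> \<bar>real (est ?Q zs) - R\<bar> \<le> e * n}"
    then have "a \<le> real (est ?Q zs) - W \<or> a \<le> - (real (est ?Q zs) - W)"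
      using RW by (auto simp: a_def)
    then have "(a / B) * a \<le> (a / B) * (real (est ?Q zs) - W) \<or> (a / B) * a \<le> (a / B) * - (real (est ?Q zs) - W)"
      using a B by (meson divide_nonneg_nonneg less_imp_le mult_left_mono)
    moreover have "(a / B) * a = a\<^sup>2 / B" "(a / B) * - v = (- a / B) * v" for v
      by (simp_all add: power2_eq_square)
    ultimately show "zs \<in> {zs. a\<^sup>2 / B \<le> (a / B) * (real (est ?Q zs) - W)} \<union>
        {zs. a\<^sup>2 / B \<le> (- a / B) * (real (est ?Q zs) - W)}"
      by (simp only: Un_iff mem_Collect_eq)
  qed simp
  also have "\<dots> \<le> d / 2 + d / 2"
    by (intro order_trans[OF measure_Un_le] add_mono tail) auto
  finally have "measure_pmf.prob (states xs) {zs. \<not> \<bar>real (est ?Q zs) - R\<bar> \<le> e * n} \<le> d" by simp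
  moreover have "{zs. \<not> \<bar>real (est ?Q zs) - R\<bar> \<le> e * n} = space (states xs) - {zs. \<bar>real (est ?Q zs) - R\<bar> \<le> e * n}"
    by auto
  ultimately show ?thesis
    using measure_pmf.prob_compl[of "{zs. \<bar>real (est ?Q zs) - R\<bar> \<le> e * n}" "states xs"]
    by (simp add: R_def n_def)
qed

end

subsection \<open>Answering queries\<close>

text \<open>The offsets are symmetric about \<open>0\<close>, and intervals of radius
  \<open>e * n\<close> around them tile the range from \<open>- J * e * n\<close> to
  \<open>J * e * n\<close>. For \<open>J = 1\<close> the noise is \<open>0\<close>.\<close>

definition grid_noise :: "nat \<Rightarrow> real \<Rightarrow> nat \<Rightarrow> real pmf" where
  "grid_noise J e n = map_pmf (\<lambda>i. (2 * real i + 1 - real J) * (e * real n)) (pmf_of_set {..<J})"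

lemma grid_noise_hits:
  assumes J: "0 < J" and e: "0 \<le> e" and D: "\<bar>D\<bar> \<le> real J * e * real n"
  shows "1 / real J \<le> measure_pmf.prob (grid_noise J e n) {u. \<bar>D - u\<bar> \<le> e * real n}"
proof -
  define u where "u = e * real n"
  have u: "0 \<le> u" using e by (simp add: u_def)
  have "\<exists>i<J. \<bar>D - (2 * real i + 1 - real J) * u\<bar> \<le> u"
  proof (cases "u = 0")
    case True
    then show ?thesis using D J by (auto simp: u_def)
  next
    case False
    \<comment> \<open>\<open>D\<close> rescaled to \<open>[0, J]\<close>, where the cells of the
      grid become unit intervals with integer ends.\<close>
    define y where "y = (D / u + real J) / 2"
    have "u > 0" using u False by simp
    have "\<bar>D\<bar> \<le> u * real J" using D by (simp add: u_def mult_ac)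
    then have y: "0 \<le> y" "y \<le> real J"
      using \<open>u > 0\<close> by (auto simp: y_def field_simps abs_le_iff)
    \<comment> \<open>The minimum assigns the right end point \<open>y = J\<close> to the last
      cell.\<close>
    define i where "i = min (nat \<lfloor>y\<rfloor>) (J - 1)"
    have i: "i < J" using J by (simp add: i_def)
    have "real i \<le> y" "y \<le> real i + 1"
    proof -
      have fl: "real (nat \<lfloor>y\<rfloor>) \<le> y" "y \<le> real (nat \<lfloor>y\<rfloor>) + 1" using y by (auto simp: of_nat_nat)
      have "real i \<le> real (nat \<lfloor>y\<rfloor>)" by (simp add: i_def)
      then show "real i \<le> y" using fl by linarith
      show "y \<le> real i + 1" using fl y J by (auto simp: i_def min_def)
    qed
    then have "\<bar>D / u - (2 * real i + 1 - real J)\<bar> \<le> 1" by (simp add: y_def abs_le_iff)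
    then have "u * \<bar>D / u - (2 * real i + 1 - real J)\<bar> \<le> u * 1" using u by (rule mult_left_mono)
    also have "u * \<bar>D / u - (2 * real i + 1 - real J)\<bar> = \<bar>u * (D / u - (2 * real i + 1 - real J))\<bar>"
      using u by (simp add: abs_mult)
    also have "u * (D / u - (2 * real i + 1 - real J)) = D - (2 * real i + 1 - real J) * u"
      using \<open>u > 0\<close> by (simp add: algebra_simps)
    finally show ?thesis using i by auto
  qed
  then obtain i where i: "i < J" "\<bar>D - (2 * real i + 1 - real J) * u\<bar> \<le> u" by blast
  have "1 / real J = measure_pmf.prob (pmf_of_set {..<J}) {i}"
    using i by (subst measure_pmf_of_set) auto
  also have "\<dots> \<le> measure_pmf.prob (pmf_of_set {..<J}) ((\<lambda>i. (2 * real i + 1 - real J) * u) -` {v. \<bar>D - v\<bar> \<le> u})"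
    using i by (intro measure_pmf.finite_measure_mono) auto
  finally show ?thesis by (simp add: grid_noise_def u_def)
qed

lemma stream_rank_filter: "stream_rank xs x = length (filter (\<lambda>y. y \<le> x) xs)"
  by (simp add: stream_rank_def length_filter_conv_card)

context sketch
begin

text \<open>With probability at least \<open>1 - d\<close> the sketch errs by at most
  \<open>J * e * n\<close>. From any such state the independent noise brings the error down to
  \<open>e * n\<close> with probability at least \<open>1 / J\<close>, so the two bounds
  multiply.\<close>

lemma sketch_solves:
  fixes e d \<delta> :: real
  assumes J: "0 < J" and e: "0 < e" and d: "0 < d"
    and K1: "4 / (real J * e) \<le> 2 ^ K" and K2: "112 * ln (2 / d) \<le> (real J * e)\<^sup>2 * 4 ^ K"
    and \<delta>: "1 - \<delta> \<le> (1 - d) / real J"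
  shows "solves_single_quantile TYPE('a::linorder) (sketch_alg (grid_noise J e)) e \<delta>"
  unfolding solves_single_quantile_def
proof (intro allI)
  fix xs :: "'a list" and x :: 'a
  let ?Q = "\<lambda>y. y \<le> x" and ?n = "length xs"
  define R where "R = real (stream_rank xs x)"
  define G where "G = {zs. \<bar>real (est ?Q zs) - R\<bar> \<le> real J * e * real ?n}"
  let ?good = "{r. \<bar>r - R\<bar> \<le> e * real ?n}"
  have G: "1 - d \<le> measure_pmf.prob (states xs) G"
    using states_concentration[of "real J * e" d xs x] J e d K1 K2
    by (simp add: G_def R_def stream_rank_filter)
  have hit: "ennreal (1 / real J) * indicator G zs
    \<le> emeasure (map_pmf ((+) (real (est ?Q zs))) (grid_noise J e ?n)) ?good" for zs
  proof (cases "zs \<in> G")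
    case True
    define D where "D = R - real (est ?Q zs)"
    have "\<bar>D\<bar> \<le> real J * e * real ?n" using True by (simp add: D_def G_def abs_minus_commute)
    then have "1 / real J \<le> measure_pmf.prob (grid_noise J e ?n) {u. \<bar>D - u\<bar> \<le> e * real ?n}"
      using J e by (intro grid_noise_hits) auto
    also have "{u. \<bar>D - u\<bar> \<le> e * real ?n} = (+) (real (est ?Q zs)) -` ?good"
      by (auto simp: D_def)
    finally show ?thesis using True by (simp add: measure_pmf.emeasure_eq_measure)
  qed simp
  have "ennreal ((1 - d) / real J) \<le> ennreal (1 / real J * measure_pmf.prob (states xs) G)"
    using divide_right_mono[OF G, of "real J"] by (intro ennreal_leI) simp
  also have "\<dots> = (\<integral>\<^sup>+ zs. ennreal (1 / real J) * indicator G zs \<partial>states xs)"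
    by (simp add: nn_integral_cmult measure_pmf.emeasure_eq_measure ennreal_mult'[symmetric])
  also have "\<dots> \<le> (\<integral>\<^sup>+ zs. emeasure (map_pmf ((+) (real (est ?Q zs))) (grid_noise J e ?n)) ?good \<partial>states xs)"
    by (intro nn_integral_mono hit)
  also have "\<dots> = emeasure (query_output (sketch_alg (grid_noise J e)) xs x) ?good"
    by (simp add: query_output_sketch emeasure_bind_pmf)
  finally have "(1 - d) / real J \<le> measure_pmf.prob (query_output (sketch_alg (grid_noise J e)) xs x) ?good"
    by (simp add: measure_pmf.emeasure_eq_measure)
  with \<delta> show "1 - \<delta> \<le> measure_pmf.prob (query_output (sketch_alg (grid_noise J e)) xs x)
      {r. \<bar>r - real (stream_rank xs x)\<bar> \<le> e * real ?n}"
    by (simp add: R_def)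
qed

end

section \<open>Choice of parameters\<close>

text \<open>The least suitable exponent overshoots by at most a factor \<open>2\<close>, unless it
  has to be raised to \<open>2\<close>, which accounts for the \<open>4\<close>.\<close>

lemma exists_power_two_near:
  fixes X :: real
  shows "\<exists>K\<ge>2. X \<le> 2 ^ K \<and> 2 ^ K \<le> 4 + 2 * max 0 X"
proof -
  define k where "k = (LEAST k. X \<le> 2 ^ k)"
  have "\<exists>k. X \<le> 2 ^ k" using real_arch_pow[of 2 X] by (auto intro: less_imp_le)
  then have k: "X \<le> 2 ^ k" unfolding k_def by (rule LeastI_ex)
  show ?thesis
  proof (cases "k \<le> 2")
    case True
    then have "(2::real) ^ k \<le> 2 ^ 2" by (intro power_increasing) auto
    then show ?thesis using k by (intro exI[of _ 2]) auto
  next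
    case False
    then have "\<not> X \<le> 2 ^ (k - 1)" unfolding k_def by (intro not_less_Least) (auto simp: k_def[symmetric])
    moreover have "(2::real) ^ k = 2 * 2 ^ (k - 1)" using False by (cases k) auto
    ultimately show ?thesis using k False by (intro exI[of _ k]) auto
  qed
qed

lemma exists_sketch:
  fixes e d \<delta> :: real
  assumes J: "0 < J" and e: "0 < e" and d: "0 < d" "d < 1" and \<delta>: "1 - \<delta> \<le> (1 - d) / real J"
    and Z: "sqrt (ln (2 / d)) / (real J * e) \<le> 5 * Z" "Z \<ge> 0"
  shows "\<exists>A. solves_single_quantile TYPE('a::linorder) A e \<delta> \<and> words_fit TYPE('a) A 2 \<and>
    space_at_most TYPE('a) A (3000 * max 1 Z)"
proof -
  define E where "E = real J * e"
  have E: "0 < E" using J e by (simp add: E_def)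
  define L where "L = ln (2 / d)"
  have "1 - 1 / 2 \<le> ln (2::real)" using ln_le_minus_one[of "1/2::real"] by (simp add: ln_div)
  also have "\<dots> \<le> L" using d unfolding L_def by (subst ln_le_cancel_iff) (auto simp: field_simps)
  finally have L: "1 / 2 \<le> L" by simp
  have sL: "1 / 2 \<le> sqrt L" using L by (intro real_le_rsqrt) (simp add: power2_eq_square)
  \<comment> \<open>The \<open>20\<close> meets both requirements on \<open>K\<close>:
    \<open>20 ^ 2\<close> exceeds \<open>112\<close>, and \<open>sqrt L \<ge> 1 / 2\<close> makes
    \<open>X\<close> at least \<open>4 / E\<close>.\<close>
  define X where "X = 20 * (sqrt L / E)"
  have X0: "0 \<le> X" using E L by (simp add: X_def)
  obtain K where K: "2 \<le> K" "X \<le> 2 ^ K" "2 ^ K \<le> 4 + 2 * X"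
    using exists_power_two_near[of X] X0 by (auto simp: max_def split: if_splits)
  interpret sketch K by unfold_locales (rule K)
  have "4 / E \<le> X" using sL E by (simp add: X_def field_simps)
  then have K1: "4 / E \<le> 2 ^ K" using K by linarith
  have "X\<^sup>2 \<le> (2 ^ K)\<^sup>2" using K X0 by (intro power_mono) auto
  also have "((2::real) ^ K)\<^sup>2 = 4 ^ K" by (simp add: power2_eq_square flip: power_mult_distrib)
  finally have "E\<^sup>2 * X\<^sup>2 \<le> E\<^sup>2 * 4 ^ K" by (rule mult_left_mono) simp
  moreover have "E\<^sup>2 * X\<^sup>2 = 400 * L" using E L by (simp add: X_def power_mult_distrib power_divide)
  ultimately have K2: "112 * L \<le> E\<^sup>2 * 4 ^ K" using L by linarith
  have "solves_single_quantile TYPE('a) (sketch_alg (grid_noise J e)) e \<delta>"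
    using sketch_solves[OF J e d(1) _ _ \<delta>] K1 K2 by (simp add: E_def L_def)
  \<comment> \<open>The left side is at most \<open>13 * (4 + 200 * Z)\<close>, that is,
    \<open>52 + 2600 * Z\<close>.\<close>
  moreover have "13 * 2 ^ K \<le> 3000 * max 1 Z"
  proof -
    have "X \<le> 100 * Z" using Z by (simp add: X_def E_def L_def)
    then show ?thesis using K(3) by linarith
  qed
  ultimately show ?thesis using sketch_words sketch_space by blast
qed

theorem theorem2:
  "\<exists>(C::real) (c::nat). C > 0 \<and>
     (\<forall>(\<epsilon>::real) (\<delta>::real). 0 < \<epsilon> \<and> \<epsilon> < 1 \<and> 0 < \<delta> \<and> \<delta> < 1 \<longrightarrow>
       (\<exists>A. solves_single_quantile TYPE('a::linorder) A \<epsilon> \<delta> \<and>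
            words_fit TYPE('a) A c \<and>
            space_at_most TYPE('a) A (C * max 1 ((1 / \<epsilon>) * sqrt (ln (1 / \<delta>))))))"
proof (rule exI[of _ 3000], rule exI[of _ 2], intro conjI allI impI; (elim conjE)?)
  fix \<epsilon> \<delta> :: real
  assume \<epsilon>: "0 < \<epsilon>" "\<epsilon> < 1" and \<delta>: "0 < \<delta>" "\<delta> < 1"
  define Z where "Z = (1 / \<epsilon>) * sqrt (ln (1 / \<delta>))"
  have ln0: "1 - \<delta> \<le> ln (1 / \<delta>)" using ln_le_minus_one[of \<delta>] \<delta> by (simp add: ln_div)
  have Z0: "0 \<le> Z" using \<epsilon> \<delta> ln0 by (simp add: Z_def)
  have "\<exists>A. solves_single_quantile TYPE('a) A \<epsilon> \<delta> \<and> words_fit TYPE('a) A 2 \<and> space_at_most TYPE('a) A (3000 * max 1 Z)"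
  \<comment> \<open>Up to \<open>15/16\<close> the logarithm of \<open>1 / \<delta>\<close> is at
    least \<open>1/16\<close>, so replacing it by that of \<open>2 / \<delta>\<close> costs a factor
    of at most \<open>25 = 5 ^ 2\<close>. Closer to \<open>1\<close> it tends to \<open>0\<close>,
    and the random grid takes over.\<close>
  proof (cases "\<delta> \<le> 15 / 16")
    case True
    have "ln (2 / \<delta>) = ln 2 + ln (1 / \<delta>)" using \<delta> by (simp add: ln_div)
    also have "\<dots> \<le> 25 * ln (1 / \<delta>)" using ln0 True ln_le_minus_one[of "2::real"] by simp
    finally have "sqrt (ln (2 / \<delta>)) \<le> sqrt (5\<^sup>2 * ln (1 / \<delta>))" by (intro real_sqrt_le_mono) simp
    also have "\<dots> = 5 * sqrt (ln (1 / \<delta>))" by (simp only: real_sqrt_mult) simp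
    finally have "sqrt (ln (2 / \<delta>)) / \<epsilon> \<le> 5 * Z" using \<epsilon> by (simp add: Z_def divide_right_mono)
    then show ?thesis using \<epsilon> \<delta> Z0 by (intro exists_sketch[of 1 \<epsilon> \<delta> \<delta> Z]) auto
  next
    case False
    define \<eta> where "\<eta> = sqrt (1 - \<delta>)"
    have \<eta>2: "\<eta>\<^sup>2 = 1 - \<delta>" using \<delta> by (simp add: \<eta>_def)
    have \<eta>: "0 < \<eta>" using \<delta> by (simp add: \<eta>_def)
    have "\<eta> \<le> 1 / 4" unfolding \<eta>_def using False by (intro real_le_lsqrt) (auto simp: power2_eq_square)
    \<comment> \<open>The success probability \<open>1 / (2 * J)\<close> has to reach
      \<open>1 - \<delta>\<close>, the square of \<open>\<eta>\<close>, which leaves room for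
      \<open>J\<close> of order \<open>1 / \<eta>\<close> as \<open>\<eta> \<le> 1 / 4\<close>. The
      larger tolerance \<open>J * \<epsilon>\<close> saves a factor \<open>\<eta>\<close> of
      space.\<close>
    define J where "J = nat \<lceil>1 / \<eta>\<rceil>"
    have J: "1 / \<eta> \<le> real J" "real J \<le> 1 / \<eta> + 1"
      using \<eta> by (auto simp: J_def)
    have J0: "0 < J" using J(1) \<eta> by (metis divide_pos_pos gr0I not_le of_nat_0 zero_less_one)
    have "1 - \<delta> \<le> (1 - 1 / 2) / real J"
    proof -
      have "\<eta> * real J \<le> 1 + \<eta>" using J(2) \<eta> by (simp add: field_simps)
      then have "\<eta> * (\<eta> * real J) \<le> \<eta> * (1 + \<eta>)" using \<eta> by (intro mult_left_mono) auto
      also have "\<dots> \<le> (1 / 4) * (1 + 1)" using \<eta> \<open>\<eta> \<le> 1 / 4\<close> by (intro mult_mono) auto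
      finally show ?thesis using J0 unfolding \<eta>2[symmetric] by (simp add: field_simps power2_eq_square)
    qed
    moreover have "sqrt (ln (2 / (1 / 2))) / (real J * \<epsilon>) \<le> 5 * Z"
    proof -
      have "ln (4::real) \<le> 5\<^sup>2" using ln_le_minus_one[of "4::real"] by simp
      then have "sqrt (ln 4) \<le> 5" by (intro real_le_lsqrt) auto
      then have "sqrt (ln 4) / (real J * \<epsilon>) \<le> 5 / (real J * \<epsilon>)" using J0 \<epsilon> by (intro divide_right_mono) auto
      also have "\<dots> \<le> 5 / (1 / \<eta> * \<epsilon>)" using J \<eta> \<epsilon> J0 by (intro divide_left_mono mult_right_mono) auto
      also have "\<dots> = 5 * (1 / \<epsilon> * \<eta>)" by simp
      also have "\<dots> \<le> 5 * Z"
        unfolding Z_def \<eta>_def using ln0 \<epsilon> by (intro mult_left_mono real_sqrt_le_mono) auto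
      finally show ?thesis by simp
    qed
    ultimately show ?thesis using \<epsilon> J0 Z0 by (intro exists_sketch[of J \<epsilon> "1/2" \<delta> Z]) auto
  qed
  then show "\<exists>A. solves_single_quantile TYPE('a) A \<epsilon> \<delta> \<and> words_fit TYPE('a) A 2 \<and>
      space_at_most TYPE('a) A (3000 * max 1 ((1 / \<epsilon>) * sqrt (ln (1 / \<delta>))))"
    by (simp add: Z_def)
qed simp

end
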